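(* For the Fibonacci-Dyck shift $F$, the multiplier $\alpha(0)$ is exceptional only at periods one, three and five; that is, for $n\in\mathbb N$ the multiplier $\alpha(0)$ is exceptional at period $n$ if and only if $n\in\{1,3,5\}$.
   Context: The Dyck inverse monoid $\mathcal D_2$ is the monoid with zero generated by $\alpha_-(0),\alpha_-(1),\alpha_+(0),\alpha_+(1)$ with relations $\alpha_-(n)\alpha_+(m)=\mathbf 1$ if $n=m$ and $=0$ if $n\ne m$. Let $\mathcal D_2^-$ (resp. $\mathcal D_2^+$) be the free semigroup (without identity) generated in $\mathcal D_2$ by $\alpha_-(0),\alpha_-(1)$ (resp. $\alpha_+(0),\alpha_+(1)$). Fibonacci-Dyck shift $F$: consider the directed graph with vertices $0,1$ and six edges: $\beta^-(0)$ and $\beta^+(0)$ are loops at vertex $0$; $\beta^-$ goes from $0$ to $1$; $\beta^-(1)$ goes from $1$ to $0$; $\beta^+$ goes from $1$ to $0$; $\beta^+(1)$ goes from $0$ to $1$. Label the edges by $\lambda(\beta^-(i))=\alpha_-(i)$, $\lambda(\beta^+(i))=\alpha_+(i)$ for $i=0,1$, and $\lambda(\beta^-)=\lambda(\beta^+)=\mathbf 1$, and for a directed path $b=(b_1,\dots,b_I)$ set $\lambda(b)=\lambda(b_1)\cdots\lambda(b_I)\in\mathcal D_2$. $F$ is the subshift over the six-letter alphabet of edges whose admissible words are exactly the finite directed paths $b$ with $\lambda(b)\neq 0$. Multipliers: a word in the symbols $\alpha(0),\alpha(1)$ is primitive if it is nonempty and not a proper power of another word; a multiplier is an equivalence class of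 primitive words under cyclic permutation, denoted by any representative. Let $p\in F$ be periodic with smallest period $\Pi(p)$ (the length of its orbit), and write $p_{[i,i+\Pi(p))}=(p_i,\dots,p_{i+\Pi(p)-1})$. The point $p$ and its orbit have negative (resp. positive) multiplier if $\lambda(p_{[i,i+\Pi(p))})\in\mathcal D_2^-$ (resp. $\in\mathcal D_2^+$) for some $i\in\mathbb Z$. For a multiplier $\mu$, they have negative multiplier $\mu_-$ if there are $i\in\mathbb Z$, a representative $\alpha(n_1)\cdots\alpha(n_J)$ of $\mu$ and $\kappa\in\mathbb N$ ($\kappa\geq1$) with $\lambda(p_{[i,i+\Pi(p))})=(\alpha_-(n_1)\cdots\alpha_-(n_J))^\kappa$; they have positive multiplier $\mu_+$ if there are such data with $\lambda(p_{[i,i+\Pi(p))})=(\alpha_+(n_J)\cdots\alpha_+(n_1))^\kappa$. For $n\in\mathbb N$ let $\mathcal O_n^-$, $\mathcal O_n^+$, $\mathcal O_n(\mu_-)$, $\mathcal O_n(\mu_+)$ be the sets of periodic orbits of $F$ of length $n$ with, respectively, negative multiplier, positive multiplier, multiplier $\mu_-$, multiplier $\mu_+$. A multiplier $\mu$ is exceptional at period $n$ if $\operatorname{card}(\mathcal O_n(\mu_-)\cup\mathcal O_n(\mu_+))>\max\{\operatorname{card}(\mathcal O_n^-),\operatorname{card}(\mathcal O_n^+)\}$. *)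

theory Defs
  imports Complex_Main "HOL-Library.Z2"
begin

section \<open>The Dyck inverse monoid\<close>

datatype dyck_gen = AMinus bit | APlus bit

text \<open>
  Words over the generators with a zero adjoined: \<^term>\<open>Some w\<close> is the word \<^term>\<open>w\<close>,
  and \<^term>\<open>None\<close> is the zero.
\<close>

fun zmult :: "dyck_gen list option \<Rightarrow> dyck_gen list option \<Rightarrow> dyck_gen list option" where
  "zmult (Some u) (Some v) = Some (u @ v)"
| "zmult None y = None"
| "zmult x None = None"

inductive dyck_cong :: "dyck_gen list option \<Rightarrow> dyck_gen list option \<Rightarrow> bool" where
  dyck_refl: "dyck_cong x x"
| dyck_sym: "dyck_cong x y \<Longrightarrow> dyck_cong y x"
| dyck_trans: "dyck_cong x y \<Longrightarrow> dyck_cong y z \<Longrightarrow> dyck_cong x z"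
| dyck_mult: "dyck_cong x x' \<Longrightarrow> dyck_cong y y' \<Longrightarrow> dyck_cong (zmult x y) (zmult x' y')"
| dyck_one: "dyck_cong (Some [AMinus n, APlus n]) (Some [])"
| dyck_zero: "n \<noteq> m \<Longrightarrow> dyck_cong (Some [AMinus n, APlus m]) None"

quotient_type dyck = "dyck_gen list option" / dyck_cong
  by (intro equivpI reflpI sympI transpI) (blast intro: dyck_cong.intros)+

instantiation dyck :: "{monoid_mult, mult_zero}"
begin

lift_definition zero_dyck :: dyck is None .

lift_definition one_dyck :: dyck is "Some []" .

lift_definition times_dyck :: "dyck \<Rightarrow> dyck \<Rightarrow> dyck" is zmult
  by (rule dyck_mult)

instance
proof
  have assoc: "zmult (zmult a b) c = zmult a (zmult b c)" for a b c
    by (cases a; cases b; cases c) simp_all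
  have one: "zmult (Some []) a = a" "zmult a (Some []) = a" for a
    by (cases a; simp)+
  have zero: "zmult None a = None" "zmult a None = None" for a
    by (cases a; simp)+
  show "a * b * c = a * (b * c)" for a b c :: dyck
    by transfer (simp add: assoc dyck_refl)
  show "1 * a = a" "a * 1 = a" for a :: dyck
    by (transfer, simp add: one dyck_refl)+
  show "0 * a = 0" "a * 0 = 0" for a :: dyck
    by (transfer, simp add: zero dyck_refl)+
qed

end

lift_definition alpha_minus :: "bit \<Rightarrow> dyck" is "\<lambda>n. Some [AMinus n]" .

lift_definition alpha_plus :: "bit \<Rightarrow> dyck" is "\<lambda>n. Some [APlus n]" .

definition dyck_minus :: "dyck set" where
  "dyck_minus = {prod_list (map alpha_minus ns) | ns. ns \<noteq> []}"

definition dyck_plus :: "dyck set" where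
  "dyck_plus = {prod_list (map alpha_plus ns) | ns. ns \<noteq> []}"


section \<open>The Fibonacci-Dyck shift\<close>

text \<open>
  \<open>BMinus i\<close> and \<open>BPlus i\<close> are the edges \<open>\<beta>\<^sup>-(i)\<close> and \<open>\<beta>\<^sup>+(i)\<close>, while
  \<open>UMinus\<close> and \<open>UPlus\<close> are the edges \<open>\<beta>\<^sup>-\<close> and \<open>\<beta>\<^sup>+\<close> that carry the label \<open>1\<close>.
  The vertices are the elements of \<^typ>\<open>bit\<close>.
\<close>

datatype edge = BMinus bit | BPlus bit | UMinus | UPlus

fun source :: "edge \<Rightarrow> bit" where
  "source (BMinus i) = i"
| "source (BPlus i) = 0"
| "source UMinus = 0"
| "source UPlus = 1"

fun target :: "edge \<Rightarrow> bit" where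
  "target (BMinus i) = 0"
| "target (BPlus i) = i"
| "target UMinus = 1"
| "target UPlus = 0"

fun edge_label :: "edge \<Rightarrow> dyck" where
  "edge_label (BMinus i) = alpha_minus i"
| "edge_label (BPlus i) = alpha_plus i"
| "edge_label UMinus = 1"
| "edge_label UPlus = 1"

definition directed_path :: "edge list \<Rightarrow> bool" where
  "directed_path b \<longleftrightarrow> successively (\<lambda>e f. target e = source f) b"

definition path_label :: "edge list \<Rightarrow> dyck" where
  "path_label b = prod_list (map edge_label b)"

text \<open>The word \<open>x\<^bsub>[i, i+n)\<^esub>\<close> of a bi-infinite sequence.\<close>

definition factor :: "(int \<Rightarrow> 'a) \<Rightarrow> int \<Rightarrow> nat \<Rightarrow> 'a list" where
  "factor x i n = map (\<lambda>k. x (i + int k)) [0..<n]"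

definition fibonacci_dyck :: "(int \<Rightarrow> edge) set" where
  "fibonacci_dyck =
     {x. \<forall>i n. directed_path (factor x i n) \<and> path_label (factor x i n) \<noteq> 0}"


section \<open>Periodic points and their orbits\<close>

definition shift_by :: "int \<Rightarrow> (int \<Rightarrow> 'a) \<Rightarrow> int \<Rightarrow> 'a" where
  "shift_by k x = (\<lambda>i. x (i + k))"

definition orbit :: "(int \<Rightarrow> 'a) \<Rightarrow> (int \<Rightarrow> 'a) set" where
  "orbit x = range (\<lambda>k. shift_by k x)"

definition periodic :: "(int \<Rightarrow> 'a) \<Rightarrow> bool" where
  "periodic x \<longleftrightarrow> (\<exists>n::nat. n > 0 \<and> shift_by (int n) x = x)"

definition min_period :: "(int \<Rightarrow> 'a) \<Rightarrow> nat" where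
  "min_period x = (LEAST n. n > 0 \<and> shift_by (int n) x = x)"


section \<open>Multipliers\<close>

text \<open>A word \<open>\<alpha>(n\<^sub>1) \<dots> \<alpha>(n\<^sub>J)\<close> is represented by the list of its indices.\<close>

definition primitive :: "'a list \<Rightarrow> bool" where
  "primitive w \<longleftrightarrow> w \<noteq> [] \<and> \<not> (\<exists>u k. k \<ge> 2 \<and> w = concat (replicate k u))"

definition cyclic_class :: "'a list \<Rightarrow> 'a list set" where
  "cyclic_class w = {rotate k w | k. True}"

definition multipliers :: "bit list set set" where
  "multipliers = {cyclic_class w | w. primitive w}"

definition period_label :: "(int \<Rightarrow> edge) \<Rightarrow> int \<Rightarrow> dyck" where
  "period_label p i = path_label (factor p i (min_period p))"

definition has_negative :: "(int \<Rightarrow> edge) \<Rightarrow> bool" where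
  "has_negative p \<longleftrightarrow> (\<exists>i. period_label p i \<in> dyck_minus)"

definition has_positive :: "(int \<Rightarrow> edge) \<Rightarrow> bool" where
  "has_positive p \<longleftrightarrow> (\<exists>i. period_label p i \<in> dyck_plus)"

definition has_multiplier_minus :: "bit list set \<Rightarrow> (int \<Rightarrow> edge) \<Rightarrow> bool" where
  "has_multiplier_minus \<mu> p \<longleftrightarrow>
     (\<exists>i. \<exists>ns\<in>\<mu>. \<exists>\<kappa>\<ge>1. period_label p i = prod_list (map alpha_minus ns) ^ \<kappa>)"

definition has_multiplier_plus :: "bit list set \<Rightarrow> (int \<Rightarrow> edge) \<Rightarrow> bool" where
  "has_multiplier_plus \<mu> p \<longleftrightarrow>
     (\<exists>i. \<exists>ns\<in>\<mu>. \<exists>\<kappa>\<ge>1. period_label p i = prod_list (map alpha_plus (rev ns)) ^ \<kappa>)"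

definition periodic_orbits :: "((int \<Rightarrow> edge) \<Rightarrow> bool) \<Rightarrow> nat \<Rightarrow> (int \<Rightarrow> edge) set set" where
  "periodic_orbits P n =
     {orbit p | p. p \<in> fibonacci_dyck \<and> periodic p \<and> min_period p = n \<and> P p}"

definition exceptional :: "bit list set \<Rightarrow> nat \<Rightarrow> bool" where
  "exceptional \<mu> n \<longleftrightarrow> \<mu> \<in> multipliers \<and>
     card (periodic_orbits (has_multiplier_minus \<mu>) n \<union>
           periodic_orbits (has_multiplier_plus \<mu>) n)
     > max (card (periodic_orbits has_negative n)) (card (periodic_orbits has_positive n))"

end

theory Submission
  imports Defs
begin

text \<open>
  Write a, A, b, B, u, U for the edges BMinus 0, BPlus 0, BMinus 1, BPlus 1, UMinus, UPlus. The
  letters a, b open and A, B close brackets of two kinds, and u, U only move between the vertices.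
  Reversing time and exchanging a with A, b with B and u with U is an anti-automorphism of the
  whole situation, so positive and negative orbits are equally numerous (card_positive,
  card_multiplier_plus). The negative orbits split into those whose unmatched openings are all a,
  the orbits with multiplier \<open>\<alpha>(0)\<close>, and those with at least one unmatched b. Hence \<open>\<alpha>(0)\<close> is
  exceptional at period n iff the first kind outnumbers the second (exceptional_iff).
  
  Up to rotation, an orbit of the first kind is a circular word a N1 a N2 ... a Nk in which each Ni
  is neutral: a path from 0 to 0 with label 1. An injection from the first kind to the second
  is obtained by rewriting the blocks Ni. A nonempty neutral word is a N A N', or u U N, or it begins
  with u b and somewhere returns by B U; it is changed, respectively, to N u b N', to u b followed by
  the changed N, and by turning that U into b. This changes neutral words to words of the same
  length whose unmatched openings are all b (promote), and the original can be recovered: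
  promote_unique. The recursion in the second clause breaks down at the empty word, where nothing
  can be changed. It starts at uUuUuU instead, which is sent to the otherwise unused uUubBb, and this
  leaves the three words without a promotion: the empty word, uU and uUuU (promote_exists).
  
  Blocks without a promotion are kept as long as some other block is promoted. If no block can be
  promoted and two are nonempty, some are changed to ub or ubub and at least one to aA or uUaA; the
  latter blocks never arise from promotion. If exactly one block is nonempty, the circular word is
  determined by its length and by whether that block is uU or uUuU, so two spare orbits of every
  length suffice: for even length words without unmatched a, for odd length words with a single block
  that is no promotion. Those words exist except for the odd lengths three and five, and the case
  that all blocks are empty is the orbit of a, of period one. For these three periods the
  orbits of both kinds are enumerated: there are 1, 2, 9 of the first and 0, 1, 7 of the second kind.
  
  Injectivity on orbits rests on the fact that the unmatched a in a circular word are determined by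
  the word itself, so that two lists of blocks giving the same circular word are rotations of each
  other (blocks_circular). The same fact shows that primitive circular words are sent to primitive
  ones.
\<close>


section \<open>Paths as runs of a stack machine\<close>

text \<open>
  A state is a vertex with the stack of openings that are still unmatched, the most recent one first.
  A run fails if the word is not a path or if its label has no value on the stack.
\<close>

fun step :: "edge \<Rightarrow> bit \<times> bit list \<Rightarrow> (bit \<times> bit list) option" where
  "step (BMinus i) (v, s) = (if v = i then Some (0, i # s) else None)"
| "step (BPlus i) (v, s) = (if v = 0 \<and> s \<noteq> [] \<and> hd s = i then Some (i, tl s) else None)"
| "step UMinus (v, s) = (if v = 0 then Some (1, s) else None)"
| "step UPlus (v, s) = (if v = 1 then Some (0, s) else None)"

fun run :: "edge list \<Rightarrow> bit \<times> bit list \<Rightarrow> (bit \<times> bit list) option" where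
  "run [] q = Some q"
| "run (e # w) q = Option.bind (step e q) (run w)"

lemma run_append: "run (x @ y) q = Option.bind (run x q) (run y)"
  by (induction x arbitrary: q) (auto split: bind_splits)

lemma run_appendE:
  assumes "run (x @ y) q = Some r"
  obtains q' where "run x q = Some q'" "run y q' = Some r"
  using assms by (auto simp: run_append bind_eq_Some_conv)

lemma run_append_Some: "run x q = Some q' \<Longrightarrow> run (x @ y) q = run y q'"
  by (simp add: run_append)

lemma step_frame: "step e (v, s) = Some (v', t) \<Longrightarrow> step e (v, s @ r) = Some (v', t @ r)"
  by (cases e) (auto split: if_splits)

lemma run_frame: "run w (v, s) = Some (v', t) \<Longrightarrow> run w (v, s @ r) = Some (v', t @ r)"
proof (induction w arbitrary: v s)
  case (Cons e w)
  then obtain v1 s1 where "step e (v, s) = Some (v1, s1)" "run w (v1, s1) = Some (v', t)"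
    by (auto simp: bind_eq_Some_conv)
  with Cons.IH step_frame[of e v s v1 s1 r] show ?case by simp
qed simp

lemma run_frame_Nil: "run w (v, []) = Some (v', t) \<Longrightarrow> run w (v, r) = Some (v', t @ r)"
  using run_frame[of w v "[]"] by simp

text \<open>
  An entry of the stack that is gone at the end has been popped by a definite letter; until then
  the run has not looked below this entry.
\<close>

lemma run_pop:
  assumes "run w (v, s @ i # r) = Some (v', t)" "i \<notin> set t"
  shows "\<exists>d w'. w = d @ BPlus i # w' \<and> run d (v, s) = Some (0, []) \<and> run w' (i, r) = Some (v', t)"
  using assms(1)
proof (induction w arbitrary: v s)
  case Nil
  with assms(2) show ?case by auto
next
  case (Cons e w)
  then obtain v1 s1 where st: "step e (v, s @ i # r) = Some (v1, s1)"
    and w: "run w (v1, s1) = Some (v', t)"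
    by (auto simp: bind_eq_Some_conv)
  show ?case
  proof (cases "s = [] \<and> (\<exists>j. e = BPlus j)")
    case True
    then have "e = BPlus i" "v = 0" "s = []" "v1 = i" "s1 = r"
      using st by (auto split: if_splits)
    with w show ?thesis by (intro exI[of _ "[]"] exI[of _ w]) simp
  next
    case False
    then obtain s2 where s2: "s1 = s2 @ i # r" "step e (v, s) = Some (v1, s2)"
      using st by (cases e; cases s) (auto split: if_splits)
    from Cons.IH[of v1 s2] w s2 obtain d w' where
      "w = d @ BPlus i # w'" "run d (v1, s2) = Some (0, [])" "run w' (i, r) = Some (v', t)"
      by auto
    with s2 show ?thesis by (intro exI[of _ "e # d"] exI[of _ w']) simp
  qed
qed

text \<open>
  The converse view: the bottom entry of the final stack was pushed by a definite letter, and
  nothing that follows has touched it.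
\<close>

lemma run_bottom:
  assumes "run w (v, []) = Some (v', s @ [i])"
  shows "\<exists>x y. w = x @ BMinus i # y \<and> run x (v, []) = Some (i, []) \<and> run y (0, []) = Some (v', s)"
  using assms
proof (induction w arbitrary: v' s rule: rev_induct)
  case (snoc e w)
  then obtain v1 s1 where w: "run w (v, []) = Some (v1, s1)"
    and st: "step e (v1, s1) = Some (v', s @ [i])"
    by (auto simp: run_append bind_eq_Some_conv)
  show ?case
  proof (cases s1 rule: rev_cases)
    case Nil
    then have "e = BMinus i" "v1 = i" "v' = 0" "s = []" using st
      by (cases e; auto split: if_splits)+
    with w Nil show ?thesis by (intro exI[of _ w] exI[of _ "[]"]) simp
  next
    case (snoc s2 j)
    have ij: "j = i" and st2: "step e (v1, s2) = Some (v', s)"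
      using st snoc by (cases e; cases s2; auto split: if_splits simp flip: append_Cons)+
    with snoc.IH[of v1 s2] w snoc obtain x y where
      "w = x @ BMinus i # y" "run x (v, []) = Some (i, [])" "run y (0, []) = Some (v1, s2)"
      by auto
    with st2 show ?thesis
      by (intro exI[of _ x] exI[of _ "y @ [e]"]) (simp add: run_append)
  qed
qed simp


section \<open>Circular words cut at their unmatched openings\<close>

definition neutral :: "edge list \<Rightarrow> bool" where
  "neutral w \<longleftrightarrow> run w (0, []) = Some (0, [])"

text \<open>
  The blocks allowed on both sides of the injection: no closing bracket reaches below the start of
  the block, and every a in it is matched within it.
\<close>

definition rising :: "edge list \<Rightarrow> bool" where
  "rising w \<longleftrightarrow> (\<exists>t. run w (0, []) = Some (0, t) \<and> 0 \<notin> set t)"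

definition blocks :: "edge list list \<Rightarrow> edge list" where
  "blocks gs = concat (map ((#) (BMinus 0)) gs)"

lemma blocks_simps [simp]:
  "blocks [] = []" "blocks (g # gs) = BMinus 0 # g @ blocks gs"
  "blocks (gs @ hs) = blocks gs @ blocks hs"
  by (simp_all add: blocks_def)

lemma blocks_eq_Nil [simp]: "blocks gs = [] \<longleftrightarrow> gs = []"
  by (cases gs) simp_all

lemma neutral_run: "neutral w \<Longrightarrow> run w (0, s) = Some (0, s)"
  unfolding neutral_def by (drule run_frame_Nil[where r = s]) simp

lemma neutral_rising: "neutral w \<Longrightarrow> rising w"
  by (auto simp: neutral_def rising_def)

lemma run_blocks:
  assumes "\<forall>g\<in>set gs. rising g"
  shows "\<exists>t. run (blocks gs) (0, s) = Some (0, t @ s) \<and>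
             (1 \<in> set t \<longleftrightarrow> (\<exists>g\<in>set gs. \<not> neutral g)) \<and> (gs \<noteq> [] \<longrightarrow> 0 \<in> set t)"
  using assms
proof (induction gs arbitrary: s)
  case (Cons g gs)
  then obtain t where t: "run g (0, []) = Some (0, t)" "0 \<notin> set t"
    by (auto simp: rising_def)
  have n: "neutral g \<longleftrightarrow> 1 \<notin> set t"
  proof
    assume "1 \<notin> set t"
    with t(2) have "t = []" by (metis bit.exhaust list.set_intros(1) neq_Nil_conv)
    with t(1) show "neutral g" by (simp add: neutral_def)
  qed (use t in \<open>auto simp: neutral_def\<close>)
  from Cons.IH[of "t @ 0 # s"] Cons.prems obtain t' where
    "run (blocks gs) (0, t @ 0 # s) = Some (0, t' @ t @ 0 # s)"
    "1 \<in> set t' \<longleftrightarrow> (\<exists>g\<in>set gs. \<not> neutral g)"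
    by (auto simp del: bit_not_zero_iff bit_not_one_iff)
  with n t run_frame_Nil[OF t(1), of "0 # s"] show ?case
    by (intro exI[of _ "t' @ t @ [0]"]) (auto simp: run_append)
qed simp

text \<open>
  A block cannot be cut so that its tail starts a new sequence of blocks: the tail would begin with
  an a that the block closes again, while in a sequence of blocks the leading a is never closed.
  Uniqueness of the factorization into blocks, both for words and for circular words, follows from
  this alone.
\<close>

lemma suffix_not_blocks:
  assumes "rising (p @ r)" "r @ z = blocks gs" "r \<noteq> []" "\<forall>g\<in>set gs. rising g"
  shows False
proof -
  from assms(2,3) obtain g hs where gs: "gs = g # hs" by (cases gs) auto
  with assms(2,3) obtain r' where r: "r = BMinus 0 # r'" and z: "r' @ z = g @ blocks hs"
    by (cases r) auto
  from assms(1) obtain t v s where t: "run p (0, []) = Some (v, s)"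
    "run r (v, s) = Some (0, t)" "0 \<notin> set t"
    unfolding rising_def by (metis run_appendE surj_pair)
  with r have "run r' (0, [] @ 0 # s) = Some (0, t)" by (auto split: if_splits)
  from run_pop[OF this t(3)] obtain d w' where d: "r' = d @ BPlus 0 # w'"
    "run d (0, []) = Some (0, [])" by blast
  from assms(4) gs obtain q where "run (g @ blocks hs) (0, []) = Some q"
    using run_blocks[of hs] unfolding rising_def by (fastforce simp: run_append)
  with z d show False by (auto simp: run_append simp flip: z)
qed

lemma blocks_inj:
  assumes "blocks gs = blocks hs" "\<forall>g\<in>set gs. rising g" "\<forall>g\<in>set hs. rising g"
  shows "gs = hs"
  using assms
proof (induction gs arbitrary: hs)
  case Nil
  then show ?case by (metis blocks_eq_Nil)
next
  case (Cons g gs)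
  then obtain h hs' where hs: "hs = h # hs'" by (cases hs) auto
  with Cons.prems have eq: "g @ blocks gs = h @ blocks hs'" by simp
  from eq obtain r where r: "g = h @ r \<and> r @ blocks gs = blocks hs' \<or>
                             h = g @ r \<and> r @ blocks hs' = blocks gs"
    unfolding append_eq_append_conv2 by metis
  have "r = []"
    using r suffix_not_blocks[of h r "blocks gs" hs'] suffix_not_blocks[of g r "blocks hs'" gs]
      Cons.prems(2,3) hs by fastforce
  with r have "g = h" "blocks gs = blocks hs'" by (elim disjE; simp)+
  with Cons.IH[of hs'] Cons.prems(2,3) hs show ?case by simp
qed

lemma blocks_split:
  assumes "p @ q = blocks gs"
  shows "(\<exists>g1 g2. gs = g1 @ g2 \<and> p = blocks g1 \<and> q = blocks g2) \<or>
         (\<exists>g1 s r g2. gs = g1 @ (s @ r) # g2 \<and> r \<noteq> [] \<and> p = blocks g1 @ BMinus 0 # s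
                      \<and> q = r @ blocks g2)"
  using assms
proof (induction gs arbitrary: p)
  case (Cons g gs)
  show ?case
  proof (cases p)
    case Nil
    with Cons.prems show ?thesis by (intro disjI1 exI[of _ "[]"] exI[of _ "g # gs"]) simp
  next
    case (Cons e p')
    with Cons.prems have e: "e = BMinus 0" and eq: "p' @ q = g @ blocks gs" by auto
    from eq consider (a) p'' where "p' = g @ p''" "p'' @ q = blocks gs"
      | (b) r where "g = p' @ r" "r \<noteq> []" "q = r @ blocks gs"
      by (force simp: append_eq_append_conv2)
    then show ?thesis
    proof cases
      case a
      from Cons.IH[OF a(2)] show ?thesis
      proof (elim disjE exE conjE)
        fix g1 g2 assume "gs = g1 @ g2" "p'' = blocks g1" "q = blocks g2"
        with a Cons e show ?thesis
          by (intro disjI1 exI[of _ "g # g1"] exI[of _ g2]) simp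
      next
        fix g1 s r g2
        assume "gs = g1 @ (s @ r) # g2" "r \<noteq> []" "p'' = blocks g1 @ BMinus 0 # s"
          "q = r @ blocks g2"
        with a Cons e show ?thesis
          by (intro disjI2 exI[of _ "g # g1"] exI[of _ s] exI[of _ r] exI[of _ g2]) simp
      qed
    next
      case b
      with Cons e show ?thesis
        by (intro disjI2 exI[of _ "[]"] exI[of _ p'] exI[of _ r] exI[of _ gs]) simp
    qed
  qed
qed simp

text \<open>
  The circular code property: the cut between p and q cannot lie inside a block.
\<close>

lemma blocks_circular:
  assumes "blocks gs = p @ q" "blocks hs = q @ p"
    and "\<forall>g\<in>set gs. rising g" "\<forall>g\<in>set hs. rising g"
  shows "\<exists>g1 g2. gs = g1 @ g2 \<and> hs = g2 @ g1 \<and> p = blocks g1 \<and> q = blocks g2"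
proof -
  from blocks_split[of p q gs] assms(1)
  consider (a) g1 g2 where "gs = g1 @ g2" "p = blocks g1" "q = blocks g2"
    | (b) g1 s r g2 where "gs = g1 @ (s @ r) # g2" "r \<noteq> []" "q = r @ blocks g2"
    by metis
  then show ?thesis
  proof cases
    case a
    then have "blocks hs = blocks (g2 @ g1)" using assms(2) by simp
    with blocks_inj[of hs "g2 @ g1"] a assms(3,4) have "hs = g2 @ g1" by auto
    with a show ?thesis by blast
  next
    case b
    with suffix_not_blocks[of s r "blocks g2 @ p" hs] assms show ?thesis by auto
  qed
qed

text \<open>
  Equivalent to primitivity; the present form says that no nontrivial rotation fixes the word, which
  is what the minimal period of the associated point depends on.
\<close>

definition aperiodic :: "'a list \<Rightarrow> bool" where
  "aperiodic w \<longleftrightarrow> w \<noteq> [] \<and> (\<forall>x y. w = x @ y \<longrightarrow> w = y @ x \<longrightarrow> x = [] \<or> y = [])"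

lemma aperiodic_blocks:
  assumes "\<forall>g\<in>set gs. rising g"
  shows "aperiodic (blocks gs) \<longleftrightarrow> aperiodic gs"
proof
  assume R: "aperiodic gs"
  show "aperiodic (blocks gs)"
    unfolding aperiodic_def
  proof (intro conjI allI impI)
    fix x y assume "blocks gs = x @ y" "blocks gs = y @ x"
    from blocks_circular[OF this assms assms] R show "x = [] \<or> y = []"
      unfolding aperiodic_def by (metis blocks_eq_Nil)
  qed (use R in \<open>simp add: aperiodic_def\<close>)
next
  assume "aperiodic (blocks gs)"
  then show "aperiodic gs"
    unfolding aperiodic_def by (metis blocks_eq_Nil blocks_simps(3))
qed



section \<open>Promoting neutral words\<close>

definition detours :: "nat \<Rightarrow> edge list" where
  "detours k = concat (replicate k [UMinus, UPlus])"

lemma detours_simps [simp]: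
  "detours 0 = []" "detours (Suc k) = UMinus # UPlus # detours k"
  by (simp_all add: detours_def)

lemma length_detours [simp]: "length (detours k) = 2 * k"
  by (induction k) auto

lemma set_detours: "set (detours k) \<subseteq> {UMinus, UPlus}"
  by (induction k) auto

lemma run_detours [simp]: "run (detours k) (0, s) = Some (0, s)"
  by (induction k) auto

text \<open>
  The word that is promoted is the one in the first argument, and its promotion is x b y, where b is
  the only unmatched opening. The three clauses are told apart by x alone: it ends with u in the
  first, begins with u b and ends with B in the second, and begins with u U and ends with B in the
  third.
\<close>

inductive promote1 :: "edge list \<Rightarrow> edge list \<Rightarrow> edge list \<Rightarrow> bool" where
  bracket: "neutral x \<Longrightarrow> neutral y \<Longrightarrow>
    promote1 (BMinus 0 # x @ BPlus 0 # y) (x @ [UMinus]) y"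
| excursion: "run (UMinus # BMinus 1 # x @ [BPlus 1]) (0, []) = Some (1, []) \<Longrightarrow> neutral y \<Longrightarrow>
    promote1 (UMinus # BMinus 1 # x @ BPlus 1 # UPlus # y) (UMinus # BMinus 1 # x @ [BPlus 1]) y"
| triple: "promote1 (detours 3) [UMinus, UPlus, UMinus, BMinus 1, BPlus 1] []"

inductive promote :: "edge list \<Rightarrow> edge list \<Rightarrow> bool" where
  once: "promote1 w x y \<Longrightarrow> promote w (x @ BMinus 1 # y)"
| delay: "promote w g \<Longrightarrow> promote (UMinus # UPlus # w) (UMinus # BMinus 1 # g)"

lemma promote1_unique: "promote1 w x y \<Longrightarrow> promote1 w' x y \<Longrightarrow> w = w'"
  by (auto elim!: promote1.cases)

lemma promote1_run:
  assumes "promote1 w x y"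
  shows "run x (0, []) = Some (1, [])" "neutral y" "length w = length x + Suc (length y)"
  using assms by (cases; simp add: run_append neutral_run; simp add: neutral_def)+

lemma promote_length: "promote w g \<Longrightarrow> length g = length w"
  by (induction rule: promote.induct) (auto dest: promote1_run(3))

lemma promote1_level: "promote1 w x y \<Longrightarrow> run (x @ BMinus 1 # y) (0, []) = Some (0, [1])"
  using promote1_run[of w x y] by (simp add: run_append neutral_run)

lemma promote_level: "promote w g \<Longrightarrow> \<exists>m. run g (0, []) = Some (0, replicate (Suc m) 1)"
proof (induction rule: promote.induct)
  case (once w x y)
  then show ?case using promote1_level by (intro exI[of _ 0]) simp
next
  case (delay w g)
  then obtain m where "run g (0, []) = Some (0, replicate (Suc m) 1)" by blast
  from run_frame_Nil[OF this, of "[1]"] show ?case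
    by (intro exI[of _ "Suc m"]) (simp add: replicate_append_same)
qed

text \<open>
  The delayed promotions carry at least two unmatched b, all others exactly one.
\<close>

lemma delay_level:
  assumes "promote w g" "run (UMinus # BMinus 1 # g) (0, []) = Some (0, t)"
  shows "length t \<ge> 2"
proof -
  from promote_level[OF assms(1)] obtain m where "run g (0, []) = Some (0, replicate (Suc m) 1)"
    by blast
  from run_frame_Nil[OF this, of "[1]"] assms(2) show ?thesis by auto
qed

lemma promote_rising: "promote w g \<Longrightarrow> rising g"
  using promote_level[of w g] by (auto simp: rising_def)

lemma promote_not_neutral: "promote w g \<Longrightarrow> \<not> neutral g"
  using promote_level[of w g] by (auto simp: neutral_def)

text \<open>
  The letters between two such places would be a prefix of a neutral word, and such a prefix
  cannot close the first of the two b.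
\<close>

lemma unmatched_split:
  assumes "x @ BMinus 1 # y = x' @ BMinus 1 # y'"
    and "run x (0, []) = Some (1, [])" "neutral y"
    and "run x' (0, []) = Some (1, [])" "neutral y'"
  shows "x = x' \<and> y = y'"
proof -
  have no: False
    if "x' = x @ BMinus 1 # z" "y = z @ BMinus 1 # y'" "run x (0, []) = Some (1, [])" "neutral y"
      "run x' (0, []) = Some (1, [])" for x x' y y' z
  proof -
    from that(1,3,5) have z: "run z (0, [1]) = Some (1, [])" by (simp add: run_append)
    from that(2,4) obtain v s where "run z (0, []) = Some (v, s)"
      unfolding neutral_def by (metis run_appendE surj_pair)
    from run_frame_Nil[OF this, of "[1]"] z show False by simp
  qed
  from assms(1) consider "x = x'" "y = y'"
    | z where "x' = x @ BMinus 1 # z" "y = z @ BMinus 1 # y'"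
    | z where "x = x' @ BMinus 1 # z" "y' = z @ BMinus 1 # y"
    unfolding append_eq_append_conv2 by (auto simp: Cons_eq_append_conv append_eq_Cons_conv)
  then show ?thesis using no assms(2-5) by cases blast+
qed

lemma promote_unique:
  assumes "promote w g" "promote w' g"
  shows "w = w'"
  using assms
proof (induction arbitrary: w' rule: promote.induct)
  case (once w x y)
  note w = once.hyps
  from once.prems show ?case
  proof cases
    case (once x' y')
    from unmatched_split[OF once(1)] promote1_run[OF w] promote1_run[OF once(2)]
    have "x = x'" "y = y'" by auto
    with w once(2) promote1_unique show ?thesis by blast
  next
    case (delay w'' g')
    with delay_level[OF delay(3), of "[1]"] promote1_level[OF w] show ?thesis by simp
  qed
next
  case (delay w g)
  from delay.prems show ?case
  proof cases
    case (once x' y')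
    with delay_level[OF delay.hyps, of "[1]"] promote1_level[OF once(2)] show ?thesis by simp
  next
    case (delay w'')
    then show ?thesis using \<open>\<And>w'. promote w' g \<Longrightarrow> w = w'\<close> by simp
  qed
qed

lemma neutral_Cons_BMinus:
  assumes "run (BMinus i # w) (v, []) = Some (v', [])"
  obtains d w' where "w = d @ BPlus i # w'" "neutral d" "run w' (i, []) = Some (v', [])"
proof -
  from assms have "run w (0, [] @ i # []) = Some (v', [])" by (auto split: if_splits)
  from run_pop[OF this] that show thesis by (auto simp: neutral_def)
qed

text \<open>
  A path that leaves vertex 0 by u and begins an inner bracket b ... B at vertex 1 may open
  further such brackets there, but it has to leave vertex 1 by U in the end.
\<close>

lemma excursion_exists:
  assumes "run (UMinus # BMinus 1 # x @ [BPlus 1]) (0, []) = Some (1, [])"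
    and "run w (1, []) = Some (0, [])"
  shows "\<exists>x' y. UMinus # BMinus 1 # x @ BPlus 1 # w = UMinus # BMinus 1 # x' @ BPlus 1 # UPlus # y \<and>
           run (UMinus # BMinus 1 # x' @ [BPlus 1]) (0, []) = Some (1, []) \<and> neutral y"
  using assms
proof (induction "length w" arbitrary: w x rule: less_induct)
  case less
  from less.prems(2) obtain e w1 where w: "w = e # w1" by (cases w) auto
  show ?case
  proof (cases e)
    case UPlus
    with less.prems w show ?thesis by (intro exI[of _ x] exI[of _ w1]) (simp add: neutral_def)
  next
    case (BMinus i)
    with less.prems(2) w have i: "i = 1" by (simp split: if_splits)
    with less.prems(2) w BMinus have "run (BMinus 1 # w1) (1, []) = Some (0, [])" by simp
    then obtain d w2 where d: "w1 = d @ BPlus 1 # w2" "neutral d" "run w2 (1, []) = Some (0, [])"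
      by (rule neutral_Cons_BMinus)
    let ?x = "x @ BPlus 1 # BMinus 1 # d"
    have "run (UMinus # BMinus 1 # ?x @ [BPlus 1]) (0, []) =
          run (BMinus 1 # d @ [BPlus 1]) (1, [])"
      using run_append_Some[OF less.prems(1), of "BMinus 1 # d @ [BPlus 1]"] by simp
    also have "\<dots> = Some (1, [])" using d(2) by (simp add: run_append neutral_run)
    finally obtain x' y where
      "UMinus # BMinus 1 # ?x @ BPlus 1 # w2 = UMinus # BMinus 1 # x' @ BPlus 1 # UPlus # y"
      "run (UMinus # BMinus 1 # x' @ [BPlus 1]) (0, []) = Some (1, [])" "neutral y"
      using less.hyps[of w2 ?x] d w by auto
    with d(1) w BMinus i show ?thesis by (intro exI[of _ x'] exI[of _ y]) simp
  qed (use less.prems(2) w in \<open>auto split: if_splits\<close>)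
qed

lemma promote_exists:
  assumes "neutral w" "w \<notin> {[], detours 1, detours 2}"
  shows "\<exists>g. promote w g"
  using assms
proof (induction "length w" arbitrary: w rule: less_induct)
  case less
  from less.prems obtain e w1 where w: "w = e # w1" by (cases w) auto
  show ?case
  proof (cases e)
    case (BMinus i)
    with less.prems(1) w have "i = 0" "run (BMinus 0 # w1) (0, []) = Some (0, [])"
      by (auto simp: neutral_def split: if_splits)
    then obtain d w2 where "w1 = d @ BPlus 0 # w2" "neutral d" "neutral w2"
      by (metis neutral_Cons_BMinus neutral_def)
    with w BMinus \<open>i = 0\<close> show ?thesis using bracket once by blast
  next
    case UMinus
    with less.prems(1) w have w1: "run w1 (1, []) = Some (0, [])" by (simp add: neutral_def)
    then obtain e' w2 where w2: "w1 = e' # w2" by (cases w1) auto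
    show ?thesis
    proof (cases e')
      case UPlus
      with w1 w2 have n: "neutral w2" by (simp add: neutral_def)
      show ?thesis
      proof (cases "w2 \<in> {[], detours 1, detours 2}")
        case True
        with less.prems(2) w w2 UMinus UPlus have "w = detours 3"
          by (auto simp: numeral_eq_Suc)
        then show ?thesis using triple once by blast
      next
        case False
        with less.hyps[of w2] n w w2 UMinus UPlus show ?thesis using delay by fastforce
      qed
    next
      case (BMinus i)
      with w1 w2 have "i = 1" "run (BMinus 1 # w2) (1, []) = Some (0, [])"
        by (auto split: if_splits)
      then obtain d w3 where d: "w2 = d @ BPlus 1 # w3" "neutral d" "run w3 (1, []) = Some (0, [])"
        by (metis neutral_Cons_BMinus)
      from d(2) have "run (UMinus # BMinus 1 # d @ [BPlus 1]) (0, []) = Some (1, [])"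
        by (simp add: run_append neutral_run)
      from excursion_exists[OF this d(3)] obtain x y where
        "UMinus # BMinus 1 # d @ BPlus 1 # w3 = UMinus # BMinus 1 # x @ BPlus 1 # UPlus # y"
        "run (UMinus # BMinus 1 # x @ [BPlus 1]) (0, []) = Some (1, [])" "neutral y"
        by blast
      with w UMinus w2 BMinus d(1) \<open>i = 1\<close> excursion once show ?thesis by metis
    qed (use w1 w2 in \<open>auto split: if_splits\<close>)
  qed (use less.prems(1) w in \<open>auto simp: neutral_def split: if_splits\<close>)
qed



section \<open>Conjugate words\<close>

definition conjugate :: "'a list \<Rightarrow> 'a list \<Rightarrow> bool" where
  "conjugate x y \<longleftrightarrow> (\<exists>p q. x = p @ q \<and> y = q @ p)"

lemma conjugate_refl: "conjugate x x"
  unfolding conjugate_def by (metis append_Nil append_Nil2)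

lemma conjugate_sym: "conjugate x y \<Longrightarrow> conjugate y x"
  unfolding conjugate_def by blast

lemma conjugate_set: "conjugate x y \<Longrightarrow> set x = set y"
  by (auto simp: conjugate_def)

lemma conjugate_length: "conjugate x y \<Longrightarrow> length x = length y"
  by (auto simp: conjugate_def)

lemma conjugate_single: "conjugate x [a] \<Longrightarrow> x = [a]"
  by (auto simp: conjugate_def append_eq_Cons_conv Cons_eq_append_conv)

lemma conjugate_blocks: "conjugate gs hs \<Longrightarrow> conjugate (blocks gs) (blocks hs)"
  unfolding conjugate_def by (metis blocks_simps(3))

lemma conjugate_blocksD:
  assumes "conjugate (blocks gs) (blocks hs)" "\<forall>g\<in>set gs. rising g" "\<forall>g\<in>set hs. rising g"
  shows "conjugate gs hs"
  using assms blocks_circular[of gs _ _ hs] unfolding conjugate_def by metis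

lemma list_all2_left_unique:
  assumes "\<And>x y z. R x z \<Longrightarrow> R y z \<Longrightarrow> x = y"
    and "list_all2 R xs zs" "list_all2 R ys zs"
  shows "xs = ys"
proof (rule nth_equalityI)
  show "length xs = length ys" using assms(2,3) by (metis list_all2_lengthD)
  show "xs ! i = ys ! i" if "i < length xs" for i
    using assms(2,3) that by (intro assms(1)[of _ "zs ! i"]) (auto simp: list_all2_conv_all_nth)
qed

lemma conjugate_list_all2:
  assumes R: "\<And>x y z. R x z \<Longrightarrow> R y z \<Longrightarrow> x = y"
    and "list_all2 R xs zs" "list_all2 R xs' zs'" "conjugate zs zs'"
  shows "conjugate xs xs'"
proof -
  from assms(4) obtain p q where pq: "zs = p @ q" "zs' = q @ p" by (auto simp: conjugate_def)
  with assms(2) obtain u v where uv: "xs = u @ v" "list_all2 R u p" "list_all2 R v q"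
    by (auto simp: list_all2_append2)
  from pq assms(3) obtain u' v' where uv': "xs' = v' @ u'" "list_all2 R u' p" "list_all2 R v' q"
    by (auto simp: list_all2_append2)
  have "u = u'" "v = v'"
    by (rule list_all2_left_unique[of R, OF R]; use uv uv' in blast)+
  with uv uv' show ?thesis by (auto simp: conjugate_def)
qed

lemma aperiodic_list_all2:
  assumes R: "\<And>x y z. R x z \<Longrightarrow> R y z \<Longrightarrow> x = y"
    and all: "list_all2 R xs zs" and ap: "aperiodic xs"
  shows "aperiodic zs"
  unfolding aperiodic_def
proof (intro conjI allI impI)
  show "zs \<noteq> []" using all ap by (auto simp: aperiodic_def)
next
  fix p q assume pq: "zs = p @ q" "zs = q @ p"
  from pq(1) all obtain u v where uv: "xs = u @ v" "list_all2 R u p" "list_all2 R v q"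
    by (auto simp: list_all2_append2)
  from pq(2) all obtain u' v' where uv': "xs = v' @ u'" "list_all2 R u' p" "list_all2 R v' q"
    by (auto simp: list_all2_append2)
  have "u = u'" "v = v'"
    by (rule list_all2_left_unique[of R, OF R]; use uv uv' in blast)+
  with uv uv' ap have "u = [] \<or> v = []" by (auto simp: aperiodic_def)
  with uv show "p = [] \<or> q = []" by auto
qed

lemma aperiodic_single: "aperiodic [x]"
  by (auto simp: aperiodic_def Cons_eq_append_conv)

lemma aperiodic_unique_letter:
  assumes "a \<notin> set x" "a \<notin> set y"
  shows "aperiodic (x @ a # y)"
  unfolding aperiodic_def
proof (intro conjI allI impI)
  fix p q assume pq: "x @ a # y = p @ q" "x @ a # y = q @ p"
  from pq(1) consider (p) z where "p = x @ a # z" "y = z @ q" | (q) z where "q = z @ a # y" "x = p @ z"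
    unfolding append_eq_append_conv2 by (auto simp: Cons_eq_append_conv)
  then show "p = [] \<or> q = []"
  proof cases
    case p
    with pq have "x @ a # y = (q @ x) @ a # z" "a \<notin> set q" using assms by auto
    with assms p(2) have "x = q @ x" using append_Cons_eq_iff[of a x y "q @ x" z] by auto
    then show ?thesis by simp
  next
    case q
    with pq have "x @ a # y = z @ a # (y @ p)" "a \<notin> set p" using assms by auto
    with assms q(2) have "y = y @ p" using append_Cons_eq_iff[of a x y z "y @ p"] by auto
    then show ?thesis by simp
  qed
qed simp


section \<open>The injection on lists of blocks\<close>

abbreviation short_detours :: "edge list set" where
  "short_detours \<equiv> {[], detours 1, detours 2}"

definition promote_or_keep :: "edge list \<Rightarrow> edge list \<Rightarrow> bool" where
  "promote_or_keep w g \<longleftrightarrow> promote w g \<or> w \<in> short_detours \<and> g = w"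

text \<open>
  The words aA and uUaA are available as values because no promotion is neutral and because
  they are different from the blocks that are kept.
\<close>

definition exchange :: "edge list \<Rightarrow> edge list \<Rightarrow> bool" where
  "exchange w g \<longleftrightarrow> w = [] \<and> g = [] \<or>
     w = detours 1 \<and> g \<in> {[UMinus, BMinus 1], [BMinus 0, BPlus 0]} \<or>
     w = detours 2 \<and> g \<in> {[UMinus, BMinus 1, UMinus, BMinus 1], [UMinus, UPlus, BMinus 0, BPlus 0]}"

lemma neutral_detours: "neutral (detours k)"
  by (simp add: neutral_def)

lemma neutral_short: "w \<in> short_detours \<Longrightarrow> neutral w"
  using neutral_detours[of 0] neutral_detours[of 1] neutral_detours[of 2] by auto

lemma promote_or_keep_unique: "promote_or_keep w g \<Longrightarrow> promote_or_keep w' g \<Longrightarrow> w = w'"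
  unfolding promote_or_keep_def using promote_unique promote_not_neutral neutral_short by metis

lemma exchange_unique: "exchange w g \<Longrightarrow> exchange w' g \<Longrightarrow> w = w'"
  unfolding exchange_def by (auto simp: numeral_eq_Suc)

lemma promote_or_keep_length: "promote_or_keep w g \<Longrightarrow> length g = length w"
  unfolding promote_or_keep_def using promote_length by auto

lemma exchange_length: "exchange w g \<Longrightarrow> length g = length w"
  unfolding exchange_def by (auto simp: numeral_eq_Suc)

lemma promote_or_keep_rising: "promote_or_keep w g \<Longrightarrow> rising g"
  unfolding promote_or_keep_def using promote_rising neutral_short neutral_rising by blast

lemma exchange_rising: "exchange w g \<Longrightarrow> rising g"
  unfolding exchange_def rising_def by (auto simp: numeral_eq_Suc)

abbreviation odd_spare1 :: "nat \<Rightarrow> edge list" where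
  "odd_spare1 r \<equiv>
     [BMinus 0, BPlus 0, UMinus, BMinus 1, BPlus 1] @ BMinus 1 # detours r"

abbreviation odd_spare2 :: "nat \<Rightarrow> edge list" where
  "odd_spare2 r \<equiv>
     [BMinus 0, BPlus 0, UMinus, BMinus 1, UMinus, BMinus 1] @ detours r"

text \<open>
  The first argument lists the blocks of the source, the second those of its image. In the last two
  clauses r counts the free detours, so the period is 2 r + 7.
\<close>

inductive block_target :: "edge list list \<Rightarrow> edge list list \<Rightarrow> bool" where
  promoted: "list_all2 promote_or_keep ws gs \<Longrightarrow> \<exists>w\<in>set ws. w \<notin> short_detours \<Longrightarrow>
    block_target ws gs"
| exchanged: "list_all2 exchange ws gs \<Longrightarrow> \<exists>g\<in>set gs. \<not> neutral g \<Longrightarrow>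
    set gs \<inter> {[BMinus 0, BPlus 0], [UMinus, UPlus, BMinus 0, BPlus 0]} \<noteq> {} \<Longrightarrow>
    block_target ws gs"
| odd1: "block_target (replicate (2 * r + 4) [] @ [detours 1]) [odd_spare1 r]"
| odd2: "block_target (replicate (2 * r + 2) [] @ [detours 2]) [odd_spare2 r]"

text \<open>
  Images without any unmatched a, for the sources of even period with a single nonempty block.
\<close>

inductive word_target :: "edge list list \<Rightarrow> edge list \<Rightarrow> bool" where
  even1: "word_target (replicate (2 * r + 1) [] @ [detours 1])
     (UMinus # BMinus 1 # detours (r + 1))"
| even2: "word_target (replicate (2 * r + 1) [] @ [detours 2])
     (UMinus # BMinus 1 # BMinus 0 # BPlus 0 # detours (r + 1))"

lemma odd_spare_run:
  "run (odd_spare1 r) (0, []) = Some (0, [1])" "run (odd_spare2 r) (0, []) = Some (0, [1, 1])"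
  by (simp_all add: run_append)

text \<open>
  The first spare block has one unmatched b, preceded by a word that begins with a and ends with B,
  which fits none of the clauses for a single opening. The second has two, but promotions with two
  unmatched b begin with u.
\<close>

lemma odd_spare_not_promoted: "\<not> promote w (odd_spare1 r)" "\<not> promote w (odd_spare2 r)"
proof -
  have hd: "hd g = UMinus" if "promote w g" "run g (0, []) = Some (0, [1, 1])" for g
    using that by cases (use promote1_level in fastforce)+
  show "\<not> promote w (odd_spare2 r)"
    using hd[OF _ odd_spare_run(2)] by auto
  show "\<not> promote w (odd_spare1 r)"
  proof
    assume "promote w (odd_spare1 r)"
    then show False
    proof cases
      case (once x y)
      have "x = [BMinus 0, BPlus 0, UMinus, BMinus 1, BPlus 1]"
        using unmatched_split[OF once(1)] promote1_run[OF once(2)] neutral_detours[of r] by simp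
      with once(2) show False by (cases; simp)
    qed simp
  qed
qed

lemma length_blocks: "length (blocks gs) = length gs + sum_list (map length gs)"
  by (induction gs) auto

lemma length_blocks_cong:
  assumes "list_all2 R ws gs" "\<And>w g. R w g \<Longrightarrow> length g = length w"
  shows "length (blocks gs) = length (blocks ws)"
  using assms(1) by induction (simp_all add: assms(2))

lemma blocks_replicate: "length (blocks (replicate k [] @ [w])) = k + 1 + length w"
  by (simp add: length_blocks sum_list_replicate)

lemma block_target_length: "block_target ws gs \<Longrightarrow> length (blocks gs) = length (blocks ws)"
  by (cases rule: block_target.cases, assumption)
     (auto simp: length_blocks sum_list_replicate
       dest: length_blocks_cong[OF _ promote_or_keep_length] length_blocks_cong[OF _ exchange_length])

lemma word_target_length: "word_target ws g \<Longrightarrow> length g = length (blocks ws)"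
  by (cases rule: word_target.cases, assumption) (auto simp: length_blocks sum_list_replicate)

lemma list_all2_rising:
  assumes "list_all2 R ws gs" "\<And>w g. R w g \<Longrightarrow> rising g"
  shows "\<forall>g\<in>set gs. rising g"
  using assms(1) by induction (auto intro: assms(2))

lemma block_target_rising:
  assumes "block_target ws gs"
  shows "\<forall>g\<in>set gs. rising g" "\<exists>g\<in>set gs. \<not> neutral g"
proof -
  show "\<forall>g\<in>set gs. rising g"
    using assms
  proof cases
    case promoted
    show ?thesis by (rule list_all2_rising[OF promoted(1)]) (rule promote_or_keep_rising)
  next
    case exchanged
    show ?thesis by (rule list_all2_rising[OF exchanged(1)]) (rule exchange_rising)
  qed (use odd_spare_run in \<open>auto simp: rising_def\<close>)
  show "\<exists>g\<in>set gs. \<not> neutral g"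
    using assms
  proof cases
    case promoted
    then obtain w where w: "w \<in> set ws" "w \<notin> short_detours" by blast
    with promoted(1) obtain g where "g \<in> set gs" "promote_or_keep w g"
      by (metis in_set_conv_nth list_all2_conv_all_nth)
    with w promote_not_neutral show ?thesis unfolding promote_or_keep_def by blast
  qed (use odd_spare_run in \<open>auto simp: neutral_def\<close>)
qed

text \<open>
  Which clause produced a list of blocks can be read off from its set of blocks, which rotation does
  not change: it consists of promotions and kept words only, or it contains aA or uUaA, or it
  is one of the spare singletons.
\<close>

lemma block_target_unique:
  assumes "block_target ws gs" "block_target ws' gs'" "conjugate gs gs'"
  shows "conjugate ws ws'"
proof -
  define P where "P gs \<longleftrightarrow> (\<forall>g\<in>set gs. (\<exists>w. promote w g) \<or> g \<in> short_detours)" for gs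
  define Q where "Q gs \<longleftrightarrow>
    set gs \<inter> {[BMinus 0, BPlus 0], [UMinus, UPlus, BMinus 0, BPlus 0]} \<noteq> {}" for gs :: "edge list list"
  have P: "P gs" if "list_all2 promote_or_keep ws gs" for ws gs
    unfolding P_def using that
    by (metis in_set_conv_nth list_all2_conv_all_nth promote_or_keep_def)
  have nPQ: "\<not> P gs" if "Q gs" for gs
  proof -
    from that obtain g where g: "g \<in> set gs"
      "g \<in> {[BMinus 0, BPlus 0], [UMinus, UPlus, BMinus 0, BPlus 0]}"
      unfolding Q_def by blast
    then have "neutral g" "g \<notin> short_detours" by (auto simp: neutral_def numeral_eq_Suc)
    with g promote_not_neutral show ?thesis unfolding P_def by blast
  qed
  have odd: "\<not> P [odd_spare1 r]" "\<not> P [odd_spare2 r]" "\<not> Q [odd_spare1 r]" "\<not> Q [odd_spare2 r]" for r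
    unfolding P_def Q_def using odd_spare_not_promoted by (auto simp: numeral_eq_Suc)
  have eq: "P gs' = P gs" "Q gs' = Q gs"
    using conjugate_set[OF assms(3)] by (auto simp: P_def Q_def)
  show ?thesis
  proof (cases "P gs")
    case True
    have *: "list_all2 promote_or_keep ws gs" if "block_target ws gs" "P gs" for ws gs
      using that by cases (use odd nPQ in \<open>auto simp: Q_def\<close>)
    from conjugate_list_all2[OF promote_or_keep_unique *[OF assms(1)] *[OF assms(2)] assms(3)]
    show ?thesis using True eq by simp
  next
    case notP: False
    show ?thesis
    proof (cases "Q gs")
      case True
      have *: "list_all2 exchange ws gs" if "block_target ws gs" "Q gs" for ws gs
        using that(1)
      proof cases
        case promoted
        with P[of ws gs] nPQ[of gs] that(2) show ?thesis by blast
      qed (use odd that(2) in simp_all)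
      from conjugate_list_all2[OF exchange_unique *[OF assms(1)] *[OF assms(2)] assms(3)]
      show ?thesis using True eq by simp
    next
      case False
      have *: "(\<exists>r. ws = replicate (2 * r + 4) [] @ [detours 1] \<and> gs = [odd_spare1 r]) \<or>
               (\<exists>r. ws = replicate (2 * r + 2) [] @ [detours 2] \<and> gs = [odd_spare2 r])"
        if "block_target ws gs" "\<not> P gs" "\<not> Q gs" for ws gs
        using that by cases (use P Q_def in blast)+
      from *[OF assms(1) notP False] obtain g where "gs = [g]" by blast
      with conjugate_single[of gs' g] conjugate_sym[OF assms(3)] have gs: "gs = gs'" by simp
      have inj: "r = s" if "detours r = detours s" for r s
        using arg_cong[OF that, of length] by simp
      from *[OF assms(1) notP False] show ?thesis
      proof (elim disjE exE conjE)
        fix r assume r: "ws = replicate (2 * r + 4) [] @ [detours 1]" "gs = [odd_spare1 r]"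
        from *[OF assms(2)] eq notP False r(2) gs inj
        have "ws' = replicate (2 * r + 4) [] @ [detours 1]" by fastforce
        with r show ?thesis by (simp add: conjugate_refl)
      next
        fix r assume r: "ws = replicate (2 * r + 2) [] @ [detours 2]" "gs = [odd_spare2 r]"
        from *[OF assms(2)] eq notP False r(2) gs inj
        have "ws' = replicate (2 * r + 2) [] @ [detours 2]" by fastforce
        with r show ?thesis by (simp add: conjugate_refl)
      qed
    qed
  qed
qed

lemma word_target_unique:
  assumes "word_target ws g" "word_target ws' g'" "set g = set g'" "length g = length g'"
  shows "ws = ws'"
  using assms(1)
proof cases
  case (even1 r)
  from assms(2) show ?thesis
    by cases (use even1 assms(3,4) set_detours[of r] in auto)
next
  case (even2 r)
  from assms(2) show ?thesis
  proof cases
    case (even1 s)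
    with even2 assms(3) set_detours[of s] show ?thesis by auto
  qed (use even2 assms(4) in auto)
qed

lemma word_target_run: "word_target ws g \<Longrightarrow> run g (0, []) = Some (0, [1])"
  by (erule word_target.cases) simp_all

lemma word_target_aperiodic:
  assumes "word_target ws g"
  shows "aperiodic g"
proof -
  have *: "BMinus 1 \<notin> set (detours k)" for k using set_detours[of k] by auto
  from assms show ?thesis
  proof cases
    case (even1 r)
    with aperiodic_unique_letter[of "BMinus 1" "[UMinus]" "detours (r + 1)"] * show ?thesis by simp
  next
    case (even2 r)
    with aperiodic_unique_letter[of "BMinus 1" "[UMinus]" "BMinus 0 # BPlus 0 # detours (r + 1)"] *
    show ?thesis by simp
  qed
qed

lemma aperiodic_replicate: "aperiodic (replicate k x) \<Longrightarrow> k = 1"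
proof -
  assume ap: "aperiodic (replicate k x)"
  then obtain m where k: "k = Suc m" by (cases k) (auto simp: aperiodic_def)
  have "replicate k x = [x] @ replicate m x" "replicate k x = replicate m x @ [x]"
    by (simp_all add: k replicate_append_same)
  with ap have "m = 0" unfolding aperiodic_def by (metis list.discI replicate_empty)
  with k show "k = 1" by simp
qed

lemma list_all2_choice:
  assumes "\<forall>x\<in>set xs. \<exists>y. R x y"
  shows "\<exists>ys. list_all2 R xs ys"
  using assms by (induction xs) (auto simp: list_all2_Cons1)

text \<open>
  The excluded lengths belong to the sources a, a uU, a a a uU and a uUuU, which consist of words
  without a promotion, at most one of them nonempty, and for which no spare image is left.
\<close>

lemma target_exists:
  assumes "\<forall>w\<in>set ws. neutral w" "aperiodic ws" "length (blocks ws) \<notin> {1, 3, 5}"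
  shows "\<exists>ws'. conjugate ws ws' \<and>
           ((\<exists>gs. block_target ws' gs \<and> aperiodic gs) \<or> (\<exists>g. word_target ws' g))"
proof (cases "\<exists>w\<in>set ws. w \<notin> short_detours")
  case True
  have "\<forall>w\<in>set ws. \<exists>g. promote_or_keep w g"
    using assms(1) promote_exists unfolding promote_or_keep_def by metis
  then obtain gs where gs: "list_all2 promote_or_keep ws gs" using list_all2_choice by blast
  have "block_target ws gs" using gs True by (rule promoted)
  moreover have "aperiodic gs"
    by (rule aperiodic_list_all2[OF _ gs assms(2)]) (rule promote_or_keep_unique)
  ultimately show ?thesis using conjugate_refl by blast
next
  case False
  then have short: "w \<in> short_detours" if "w \<in> set ws" for w using that by blast
  show ?thesis
  proof (cases "\<exists>w\<in>set ws. w \<noteq> []")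
    case False
    then have "ws = replicate (length ws) []" by (metis replicate_eqI)
    with assms(2) aperiodic_replicate[of "length ws" "[]"] have "ws = [[]]"
      by (metis One_nat_def replicate_Suc replicate_empty)
    with assms(3) show ?thesis by simp
  next
    case True
    then obtain xs w ys where ws: "ws = xs @ w # ys" and w: "w \<noteq> []" and xs: "\<forall>v\<in>set xs. v = []"
      using split_list_first_prop[of ws "\<lambda>w. w \<noteq> []"] by blast
    show ?thesis
    proof (cases "\<exists>v\<in>set ys. v \<noteq> []")
      case True
      then obtain v where v: "v \<in> set ys" "v \<noteq> []" by blast
      define f :: "edge list \<Rightarrow> edge list" where
        "f v = (if v = [] then [] else if v = detours 1 then [BMinus 0, BPlus 0]
                else [UMinus, UPlus, BMinus 0, BPlus 0])" for v
      have f: "exchange v (f v)" if "v \<in> set ws" for v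
        using short[OF that] by (auto simp: f_def exchange_def)
      have "w = detours 1 \<or> w = detours 2" using short[of w] ws w by auto
      then have "\<exists>g. exchange w g \<and> \<not> neutral g"
      proof
        assume "w = detours 1"
        then show ?thesis
          by (intro exI[of _ "[UMinus, BMinus 1]"]) (simp add: exchange_def neutral_def)
      next
        assume "w = detours 2"
        then show ?thesis
          by (intro exI[of _ "[UMinus, BMinus 1, UMinus, BMinus 1]"])
             (simp add: exchange_def neutral_def)
      qed
      then obtain g where g: "exchange w g" "\<not> neutral g" by blast
      define gs where "gs = map f xs @ g # map f ys"
      have all: "list_all2 exchange ws gs"
        using f g(1) by (simp add: ws gs_def list_all2_append list_all2_map2 list_all2_same)
      have "f v \<in> set gs" using v by (simp add: gs_def)
      then have "set gs \<inter> {[BMinus 0, BPlus 0], [UMinus, UPlus, BMinus 0, BPlus 0]} \<noteq> {}"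
        using v(2) by (auto simp: f_def split: if_splits)
      with all g(2) have "block_target ws gs"
        by (intro exchanged) (auto simp: gs_def)
      moreover have "aperiodic gs"
        by (rule aperiodic_list_all2[OF _ all assms(2)]) (rule exchange_unique)
      ultimately show ?thesis using conjugate_refl by blast
    next
      case False
      define k where "k = length (ys @ xs)"
      have "ys @ xs = replicate k []" using False xs unfolding k_def by (metis Un_iff replicate_eqI set_append)
      then have conj: "conjugate ws (replicate k [] @ [w])"
        unfolding ws conjugate_def by (intro exI[of _ "xs @ [w]"] exI[of _ ys]) simp
      have len: "length (blocks ws) = k + 1 + length w"
        using blocks_replicate[of k w] conjugate_length[OF conjugate_blocks[OF conj]] by simp
      consider "w = detours 1" | "w = detours 2" using short[of w] ws w by auto
      then show ?thesis
      proof cases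
        case 1
        with len assms(3) have "k \<noteq> 0" "k \<noteq> 2" by auto
        show ?thesis
        proof (cases "even k")
          case True
          with \<open>k \<noteq> 0\<close> \<open>k \<noteq> 2\<close> have "k = 2 * ((k - 4) div 2) + 4" by presburger
          with conj 1 odd1[of "(k - 4) div 2"] aperiodic_single show ?thesis by metis
        next
          case False
          then obtain r where "k = 2 * r + 1" by (rule oddE)
          with conj 1 even1[of r] show ?thesis by metis
        qed
      next
        case 2
        with len assms(3) have "k \<noteq> 0" by auto
        show ?thesis
        proof (cases "even k")
          case True
          with \<open>k \<noteq> 0\<close> have "k = 2 * ((k - 2) div 2) + 2" by presburger
          with conj 2 odd2[of "(k - 2) div 2"] aperiodic_single show ?thesis by metis
        next
          case False
          then obtain r where "k = 2 * r + 1" by (rule oddE)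
          with conj 2 even2[of r] show ?thesis by metis
        qed
      qed
    qed
  qed
qed



section \<open>The Dyck inverse monoid acting on stacks\<close>

text \<open>
  The representation of the monoid by partial maps on stacks: \<open>\<alpha>\<^sub>-(n)\<close> pushes n, \<open>\<alpha>\<^sub>+(n)\<close> pops n.
  It shows that elements are nonzero or different.
\<close>

fun gen_act :: "dyck_gen \<Rightarrow> bit list \<Rightarrow> bit list option" where
  "gen_act (AMinus n) s = Some (n # s)"
| "gen_act (APlus n) [] = None"
| "gen_act (APlus n) (m # s) = (if m = n then Some s else None)"

fun word_act :: "dyck_gen list option \<Rightarrow> bit list \<Rightarrow> bit list option" where
  "word_act None s = None"
| "word_act (Some []) s = Some s"
| "word_act (Some (g # w)) s = Option.bind (gen_act g s) (word_act (Some w))"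

lemma word_act_zmult: "word_act (zmult x y) s = Option.bind (word_act x s) (word_act y)"
proof (cases x)
  case (Some u)
  show ?thesis
  proof (cases y)
    case (Some v)
    have "word_act (Some (u @ v)) s = Option.bind (word_act (Some u) s) (word_act (Some v))"
      by (induction u arbitrary: s) (auto split: bind_splits)
    with \<open>x = Some u\<close> Some show ?thesis by simp
  next
    case None
    have "word_act None = (\<lambda>_. None)" by auto
    with \<open>x = Some u\<close> None show ?thesis by simp
  qed
qed simp

lemma word_act_cong: "dyck_cong x y \<Longrightarrow> word_act x s = word_act y s"
proof (induction arbitrary: s rule: dyck_cong.induct)
  case (dyck_mult x x' y y')
  then have "word_act y = word_act y'" by blast
  with dyck_mult show ?case by (simp add: word_act_zmult)
qed auto

lift_definition act :: "dyck \<Rightarrow> bit list \<Rightarrow> bit list option" is word_act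
  by (rule ext) (rule word_act_cong)

lemma act_simps [simp]:
  "act 0 s = None" "act 1 s = Some s" "act (alpha_minus n) s = Some (n # s)"
  by (simp_all add: zero_dyck_def one_dyck_def alpha_minus_def act.abs_eq)

lemma act_plus [simp]:
  "act (alpha_plus n) s = (if s \<noteq> [] \<and> hd s = n then Some (tl s) else None)"
  by (cases s) (simp_all add: alpha_plus_def act.abs_eq)

lemma act_mult: "act (x * y) s = Option.bind (act x s) (act y)"
  by transfer (rule word_act_zmult)

lemma act_minus_word: "act (prod_list (map alpha_minus ns)) s = Some (rev ns @ s)"
  by (induction ns arbitrary: s) (simp_all add: act_mult)

lemma minus_plus: "alpha_minus n * alpha_plus n = 1"
  by transfer (simp add: dyck_one)

lemma path_label_simps [simp]:
  "path_label [] = 1" "path_label (e # w) = edge_label e * path_label w"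
  by (simp_all add: path_label_def)

text \<open>
  A run that starts on the empty stack computes the label as a product of the generators
  \<open>\<alpha>\<^sub>-(n)\<close>; so the stack determines the label, and not only conversely.
\<close>

lemma run_label:
  assumes "run w (v, s) = Some (v', t)"
  shows "prod_list (map alpha_minus (rev s)) * path_label w = prod_list (map alpha_minus (rev t))"
  using assms
proof (induction w arbitrary: v s)
  case (Cons e w)
  then obtain v1 s1 where st: "step e (v, s) = Some (v1, s1)" and w: "run w (v1, s1) = Some (v', t)"
    by (auto simp: bind_eq_Some_conv)
  have "prod_list (map alpha_minus (rev s)) * edge_label e = prod_list (map alpha_minus (rev s1))"
    using st by (cases e; cases s; auto split: if_splits simp: mult.assoc minus_plus)
  with Cons.IH[OF w] show ?case by (simp flip: mult.assoc)
qed simp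

lemma run_act: "run w (v, s) = Some (v', t) \<Longrightarrow> act (path_label w) s = Some t"
proof (induction w arbitrary: v s)
  case (Cons e w)
  then obtain v1 s1 where st: "step e (v, s) = Some (v1, s1)" and w: "run w (v1, s1) = Some (v', t)"
    by (auto simp: bind_eq_Some_conv)
  have "act (edge_label e) s = Some s1" using st by (cases e; auto split: if_splits)
  with Cons.IH[OF w] show ?case by (simp add: act_mult)
qed simp

lemma step_vertices: "step e (v, s) = Some (v', t) \<Longrightarrow> v = source e \<and> v' = target e"
  by (cases e) (auto split: if_splits)

lemma run_directed: "run w (v, s) = Some (v', t) \<Longrightarrow> directed_path w"
proof (induction w arbitrary: v s)
  case (Cons e w)
  then obtain v1 s1 where st: "step e (v, s) = Some (v1, s1)" and w: "run w (v1, s1) = Some (v', t)"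
    by (auto simp: bind_eq_Some_conv)
  from Cons.IH[OF w] w step_vertices[OF st] show ?case
    by (cases w) (auto simp: directed_path_def bind_eq_Some_conv dest: step_vertices)
qed (simp add: directed_path_def)

lemma act_run:
  assumes "directed_path w" "w \<noteq> []" "act (path_label w) s = Some t"
  shows "run w (source (hd w), s) = Some (target (last w), t)"
  using assms
proof (induction w arbitrary: s)
  case (Cons e w)
  from Cons.prems(3) obtain s1 where s1: "act (edge_label e) s = Some s1" "act (path_label w) s1 = Some t"
    by (auto simp: act_mult bind_eq_Some_conv)
  have st: "step e (source e, s) = Some (target e, s1)"
    using s1(1) by (cases e) (auto split: if_splits)
  show ?case
  proof (cases w)
    case Nil
    with st s1(2) show ?thesis by simp
  next
    case (Cons f w')
    with Cons.prems(1) have "directed_path w" "target e = source f"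
      by (auto simp: directed_path_def)
    with Cons.IH[of s1] s1(2) Cons st show ?thesis by simp
  qed
qed simp


section \<open>Periodic points and circular words\<close>

definition point :: "'a list \<Rightarrow> int \<Rightarrow> 'a" where
  "point w i = w ! nat (i mod int (length w))"

lemma conjugate_rotate: "conjugate x y \<longleftrightarrow> (\<exists>j. y = rotate j x)"
proof
  assume "conjugate x y"
  then obtain p q where "x = p @ q" "y = q @ p" by (auto simp: conjugate_def)
  then show "\<exists>j. y = rotate j x" by (metis rotate_append)
next
  assume "\<exists>j. y = rotate j x"
  then show "conjugate x y" unfolding conjugate_def rotate_drop_take by (metis append_take_drop_id)
qed

lemma shift_point:
  assumes "w \<noteq> []"
  shows "shift_by k (point w) = point (rotate (nat (k mod int (length w))) w)"
proof
  fix i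
  let ?n = "int (length w)"
  have n: "?n > 0" using assms by simp
  have "nat ((i + k) mod ?n) = (nat (k mod ?n) + nat (i mod ?n)) mod length w"
    using n by (simp add: nat_eq_iff zmod_int mod_simps add.commute)
  with n show "shift_by k (point w) i = point (rotate (nat (k mod ?n)) w) i"
    by (simp add: shift_by_def point_def nth_rotate nat_less_iff)
qed

lemma factor_point: "w \<noteq> [] \<Longrightarrow> factor (point w) 0 (length w) = w"
  by (rule nth_equalityI) (simp_all add: factor_def point_def)

lemma factor_append: "factor x i (m + n) = factor x i m @ factor x (i + int m) n"
  by (rule nth_equalityI) (auto simp: factor_def nth_append)

lemma length_factor [simp]: "length (factor x i n) = n"
  by (simp add: factor_def)

lemma factor_shift: "factor (shift_by k x) i n = factor x (i + k) n"
  by (simp add: factor_def shift_by_def algebra_simps)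

lemma shift_shift: "shift_by j (shift_by k x) = shift_by (j + k) x"
  by (simp add: shift_by_def algebra_simps)

lemma shift_0 [simp]: "shift_by 0 x = x"
  by (simp add: shift_by_def)

lemma orbit_shift: "orbit (shift_by k x) = orbit x"
proof -
  have "shift_by j x \<in> range (\<lambda>i. shift_by (i + k) x)" for j
    by (rule range_eqI[of _ _ "j - k"]) simp
  then show ?thesis unfolding orbit_def by (auto simp: shift_shift)
qed

lemma shift_period_multiple:
  assumes "shift_by n x = x"
  shows "shift_by (n * k) x = x"
proof -
  have nat: "shift_by (n * int m) x = x" for m
  proof (induction m)
    case (Suc m)
    have "shift_by (n * int (Suc m)) x = shift_by n (shift_by (n * int m) x)"
      by (simp add: shift_shift distrib_left)
    then show ?case using Suc assms by simp
  qed simp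
  have neg: "shift_by (- (n * int m)) x = x" for m
  proof -
    have "shift_by (- (n * int m)) (shift_by (n * int m) x) = x" by (simp add: shift_shift)
    then show ?thesis using nat by simp
  qed
  show ?thesis using nat neg by (cases k) (metis, metis mult_minus_right)
qed

lemma point_factor:
  assumes "shift_by (int n) x = x" "n > 0"
  shows "point (factor x 0 n) = x"
proof
  fix i
  have "x i = shift_by (int n * (i div int n)) x (i mod int n)"
    by (simp add: shift_by_def)
  also have "\<dots> = x (i mod int n)" by (simp add: shift_period_multiple[OF assms(1)])
  finally show "point (factor x 0 n) i = x i"
    using assms(2) by (simp add: point_def factor_def nat_less_iff)
qed

lemma orbit_point_eq:
  assumes "length w = length w'" "w \<noteq> []"
  shows "orbit (point w) = orbit (point w') \<longleftrightarrow> conjugate w w'"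
proof
  assume "orbit (point w) = orbit (point w')"
  then have "point w' \<in> orbit (point w)" unfolding orbit_def by (metis rangeI shift_0)
  then obtain k where "point w' = shift_by k (point w)" by (auto simp: orbit_def)
  then have "point w' = point (rotate (nat (k mod int (length w))) w)"
    using shift_point assms(2) by metis
  then have "w' = rotate (nat (k mod int (length w))) w"
    using factor_point[of w'] factor_point[of "rotate (nat (k mod int (length w))) w"] assms
    by (metis length_0_conv length_rotate)
  then show "conjugate w w'" by (auto simp: conjugate_rotate)
next
  assume "conjugate w w'"
  then obtain p q where pq: "w = p @ q" "w' = q @ p" by (auto simp: conjugate_def)
  show "orbit (point w) = orbit (point w')"
  proof (cases "q = []")
    case False
    have "shift_by (int (length p)) (point w) = point w'"
      using shift_point[of w "int (length p)"] pq False by (simp add: rotate_append)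
    then show ?thesis using orbit_shift by metis
  qed (use pq in simp)
qed

lemma min_periodD:
  assumes "periodic x"
  shows "min_period x > 0" "shift_by (int (min_period x)) x = x"
  using LeastI_ex[OF assms[unfolded periodic_def]] by (simp_all add: min_period_def)

lemma min_period_le: "m > 0 \<Longrightarrow> shift_by (int m) x = x \<Longrightarrow> min_period x \<le> m"
  unfolding min_period_def by (rule Least_le) simp

lemma aperiodic_min_period:
  assumes "aperiodic w"
  shows "periodic (point w)" "min_period (point w) = length w"
proof -
  from assms have w: "w \<noteq> []" by (simp add: aperiodic_def)
  have sh: "shift_by (int (length w)) (point w) = point w"
    using shift_point[OF w, of "int (length w)"] by simp
  with w show per: "periodic (point w)" unfolding periodic_def by (metis length_greater_0_conv)
  let ?m = "min_period (point w)"
  have m: "?m > 0" "shift_by (int ?m) (point w) = point w" using min_periodD[OF per] by auto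
  have "\<not> ?m < length w"
  proof
    assume lt: "?m < length w"
    then have "point (rotate ?m w) = point w" using shift_point[OF w, of "int ?m"] m by simp
    then have "rotate ?m w = w"
      using factor_point[OF w] factor_point[of "rotate ?m w"] w by simp
    then have "w = drop ?m w @ take ?m w" using lt by (simp add: rotate_drop_take)
    moreover have "w = take ?m w @ drop ?m w" by simp
    ultimately have "take ?m w = [] \<or> drop ?m w = []" using assms unfolding aperiodic_def by blast
    with lt m(1) show False by auto
  qed
  with min_period_le[of "length w" "point w"] sh w show "?m = length w" by simp
qed

text \<open>
  Reading off one period and repeating it periodically are inverse to each other up to the shift.
\<close>

lemma aperiodic_factor:
  assumes "periodic x"
  shows "aperiodic (factor x i (min_period x))" (is "aperiodic ?w")
    and "orbit (point (factor x i (min_period x))) = orbit x"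
proof -
  let ?n = "min_period x"
  note n = min_periodD[OF assms]
  have "shift_by (int ?n) (shift_by i x) = shift_by i x"
    using n(2) by (metis add.commute shift_shift)
  from point_factor[OF this n(1)] have pt: "point ?w = shift_by i x" by (simp add: factor_shift)
  then show "orbit (point ?w) = orbit x" by (simp add: orbit_shift)
  have ne: "?w \<noteq> []" using n(1) by (metis length_factor length_0_conv less_irrefl)
  show "aperiodic ?w"
    unfolding aperiodic_def
  proof (intro conjI allI impI ne)
    fix p q assume pq: "?w = p @ q" "?w = q @ p"
    show "p = [] \<or> q = []"
    proof (rule ccontr)
      assume "\<not> (p = [] \<or> q = [])"
      then have "length p > 0" "length q > 0" by auto
      moreover have "length p + length q = ?n" using pq(1) by (metis length_append length_factor)
      ultimately have lt: "length p < ?n" "length p > 0" by linarith+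
      have "rotate (length p) ?w = ?w" using pq rotate_append by metis
      then have "shift_by (int (length p)) (point ?w) = point ?w"
        using shift_point[OF ne, of "int (length p)"] lt by simp
      then have "shift_by (- i) (shift_by (int (length p) + i) x) = shift_by (- i) (shift_by i x)"
        using pt by (simp add: shift_shift)
      then have "shift_by (int (length p)) x = x" by (simp add: shift_shift)
      with min_period_le[OF lt(2)] lt(1) show False by fastforce
    qed
  qed
qed

text \<open>
  A loop of the graph whose run succeeds on the empty stack can be repeated forever, because
  entries added at the bottom of the stack do no harm; every factor of the periodic point is then
  part of a successful run.
\<close>

lemma run_point:
  assumes "run w (v, []) = Some (v, t)" "w \<noteq> []"
  shows "point w \<in> fibonacci_dyck"
proof -
  let ?n = "length w"
  have per: "factor (point w) (int (k * ?n)) ?n = w" for k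
    using factor_shift[of "int (k * ?n)" "point w" 0 ?n] shift_point[OF assms(2), of "int (k * ?n)"]
      factor_point[OF assms(2)] by simp
  have full: "\<exists>t. run (factor (point w) 0 (k * ?n)) (v, []) = Some (v, t)" for k
  proof (induction k)
    case (Suc k)
    then obtain t' where t': "run (factor (point w) 0 (k * ?n)) (v, []) = Some (v, t')" by blast
    have "factor (point w) 0 (Suc k * ?n) = factor (point w) 0 (k * ?n) @ w"
      using factor_append[of "point w" 0 "k * ?n" ?n] per[of k] by (simp add: add.commute)
    with t' run_frame_Nil[OF assms(1)] show ?case by (simp add: run_append)
  qed (simp add: factor_def)
  have pre: "\<exists>q. run (factor (point w) 0 m) (v, []) = Some q" for m
  proof -
    have "m \<le> m * ?n" using assms(2) by (cases w) auto
    then obtain d where "m * ?n = m + d" using le_Suc_ex by blast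
    with full[of m] factor_append[of "point w" 0 m d] show ?thesis
      by (metis run_appendE)
  qed
  have fac: "\<exists>q r. run (factor (point w) i m) q = Some r" for i m
  proof -
    let ?j = "nat (i mod int ?n)"
    have "shift_by (int ?j) (point w) = shift_by i (point w)"
      using shift_point[OF assms(2)] assms(2) by simp
    then have "factor (point w) i m = factor (point w) (int ?j) m"
      using factor_shift[of _ "point w" 0 m] by (metis add_0)
    with pre[of "?j + m"] factor_append[of "point w" 0 ?j m] show ?thesis
      by (metis add_0 run_appendE)
  qed
  show ?thesis
    unfolding fibonacci_dyck_def
  proof (intro CollectI allI)
    fix i m
    from fac[of i m] obtain v s v' t where r: "run (factor (point w) i m) (v, s) = Some (v', t)"
      by (metis surj_pair)
    from run_act[OF r] have "path_label (factor (point w) i m) \<noteq> 0" by auto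
    with run_directed[OF r]
    show "directed_path (factor (point w) i m) \<and> path_label (factor (point w) i m) \<noteq> 0" by simp
  qed
qed


section \<open>Orbits with negative multiplier\<close>

definition loop_orbits :: "(bit list \<Rightarrow> bool) \<Rightarrow> nat \<Rightarrow> (int \<Rightarrow> edge) set set" where
  "loop_orbits P n =
     {orbit (point w) | w v t. length w = n \<and> aperiodic w \<and> run w (v, []) = Some (v, t) \<and> P t}"

text \<open>
  Membership in the shift supplies the edge after the period as well, which is why one period is a
  closed path.
\<close>

lemma periodic_orbits_eq:
  "periodic_orbits (\<lambda>p. \<exists>i ns. P (rev ns) \<and> period_label p i = prod_list (map alpha_minus ns)) n =
   loop_orbits P n" (is "?L = ?R")
proof
  show "?L \<subseteq> ?R"
  proof
    fix X assume "X \<in> ?L"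
    then obtain p i ns where p: "p \<in> fibonacci_dyck" "periodic p" "min_period p = n" "X = orbit p"
      and ns: "P (rev ns)" "period_label p i = prod_list (map alpha_minus ns)"
      by (auto simp: periodic_orbits_def)
    define w where "w = factor p i n"
    have n: "n > 0" "shift_by (int n) p = p" using min_periodD[OF p(2)] p(3) by auto
    then have ne: "w \<noteq> []" by (metis length_factor length_0_conv less_irrefl w_def)
    have hd: "hd w = p i"
      using n(1) by (simp add: w_def factor_def hd_map upt_conv_Cons)
    have "p (i + int n) = p i" using fun_cong[OF n(2), of i] by (simp add: shift_by_def)
    then have "factor p i (n + 1) = w @ [hd w]"
      using factor_append[of p i n 1] hd by (simp add: w_def factor_def)
    moreover have "directed_path (factor p i (n + 1))" using p(1) by (simp add: fibonacci_dyck_def)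
    ultimately have dir: "directed_path w" "target (last w) = source (hd w)"
      using ne by (auto simp: directed_path_def successively_append_iff)
    have "act (path_label w) [] = Some (rev ns)"
      using ns(2) p(3) by (simp add: period_label_def w_def act_minus_word)
    from act_run[OF dir(1) ne this] dir(2)
    have "run w (source (hd w), []) = Some (source (hd w), rev ns)" by simp
    moreover have "aperiodic w" "X = orbit (point w)"
      using aperiodic_factor[OF p(2), of i] p(3,4) by (simp_all add: w_def)
    ultimately show "X \<in> ?R" unfolding loop_orbits_def using ns(1) w_def length_factor by blast
  qed
  show "?R \<subseteq> ?L"
  proof
    fix X assume "X \<in> ?R"
    then obtain w v t where w: "X = orbit (point w)" "length w = n" "aperiodic w"
      "run w (v, []) = Some (v, t)" "P t"
      by (auto simp: loop_orbits_def)
    then have ne: "w \<noteq> []" by (simp add: aperiodic_def)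
    have "period_label (point w) 0 = prod_list (map alpha_minus (rev t))"
      using run_label[OF w(4)] aperiodic_min_period(2)[OF w(3)]
      by (simp add: period_label_def factor_point[OF ne])
    with w run_point[OF w(4) ne] aperiodic_min_period[OF w(3)] show "X \<in> ?L"
      unfolding periodic_orbits_def by (auto intro!: exI[of _ "point w"] exI[of _ 0] exI[of _ "rev t"])
  qed
qed

lemma negative_orbits: "periodic_orbits has_negative n = loop_orbits (\<lambda>t. t \<noteq> []) n"
proof -
  have "has_negative = (\<lambda>p. \<exists>i ns. rev ns \<noteq> [] \<and> period_label p i = prod_list (map alpha_minus ns))"
    by (auto simp: fun_eq_iff has_negative_def dyck_minus_def)
  with periodic_orbits_eq[of "\<lambda>t. t \<noteq> []" n] show ?thesis by simp
qed

lemma class_zero: "cyclic_class [0] = {[0]}"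
  by (auto simp: cyclic_class_def)

lemma zeros_iff: "t \<noteq> [] \<and> (1::bit) \<notin> set t \<longleftrightarrow> (\<exists>k\<ge>1. t = replicate k 0)"
proof
  assume t: "t \<noteq> [] \<and> (1::bit) \<notin> set t"
  then have "\<forall>x\<in>set t. x = 0" by (metis bit.exhaust)
  then have "t = replicate (length t) 0" by (metis replicate_eqI)
  with t show "\<exists>k\<ge>1. t = replicate k 0" by (metis One_nat_def Suc_leI length_greater_0_conv)
qed auto

lemma multiplier_zero_orbits:
  "periodic_orbits (has_multiplier_minus (cyclic_class [0])) n =
   loop_orbits (\<lambda>t. t \<noteq> [] \<and> 1 \<notin> set t) n"
proof -
  have pow: "prod_list (map alpha_minus (replicate k 0)) = alpha_minus 0 ^ k" for k
    by (induction k) auto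
  have "has_multiplier_minus (cyclic_class [0]) p \<longleftrightarrow> (\<exists>i ns. (rev ns \<noteq> [] \<and> 1 \<notin> set (rev ns)) \<and>
      period_label p i = prod_list (map alpha_minus ns))" (is "?M \<longleftrightarrow> ?N") for p
  proof
    assume ?M
    then obtain i k where "k \<ge> 1" "period_label p i = prod_list (map alpha_minus (replicate k 0))"
      unfolding has_multiplier_minus_def class_zero pow by auto
    then show ?N by (intro exI[of _ i] exI[of _ "replicate k 0"]) simp
  next
    assume ?N
    then obtain i ns where ns: "rev ns \<noteq> [] \<and> 1 \<notin> set (rev ns)"
      "period_label p i = prod_list (map alpha_minus ns)" by blast
    from ns(1)[unfolded zeros_iff] obtain k where k: "k \<ge> 1" "rev ns = replicate k 0" by blast
    then have "ns = replicate k 0" by (metis rev_replicate rev_rev_ident)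
    with ns(2) k(1) show ?M unfolding has_multiplier_minus_def class_zero by (auto simp: pow)
  qed
  then have "has_multiplier_minus (cyclic_class [0]) = (\<lambda>p. \<exists>i ns. (rev ns \<noteq> [] \<and> 1 \<notin> set (rev ns)) \<and>
      period_label p i = prod_list (map alpha_minus ns))" by (rule ext)
  with periodic_orbits_eq[of "\<lambda>t. t \<noteq> [] \<and> 1 \<notin> set t" n] show ?thesis by simp
qed

text \<open>
  The net number of openings of kind i, as an invariant of circular words: it is additive and
  therefore does not depend on the starting point.
\<close>

definition level :: "bit \<Rightarrow> edge list \<Rightarrow> int" where
  "level i w = (\<Sum>e\<leftarrow>w. if e = BMinus i then 1 else if e = BPlus i then -1 else 0)"

lemma run_level: "run w (v, s) = Some (v', t) \<Longrightarrow>
  int (count_list t i) = int (count_list s i) + level i w"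
proof (induction w arbitrary: v s)
  case (Cons e w)
  then obtain v1 s1 where st: "step e (v, s) = Some (v1, s1)" and w: "run w (v1, s1) = Some (v', t)"
    by (auto simp: bind_eq_Some_conv)
  have "int (count_list s1 i) = int (count_list s i) + level i [e]"
    using st by (cases e; cases s; auto split: if_splits simp: level_def)
  with Cons.IH[OF w] show ?case by (simp add: level_def)
qed (simp add: level_def)

lemma conjugate_level: "conjugate x y \<Longrightarrow> level i x = level i y"
  by (auto simp: conjugate_def level_def)

lemma loop_orbits_split:
  "loop_orbits (\<lambda>t. t \<noteq> []) n =
   loop_orbits (\<lambda>t. t \<noteq> [] \<and> 1 \<notin> set t) n \<union> loop_orbits (\<lambda>t. 1 \<in> set t) n"
proof -
  have "t \<noteq> [] \<longleftrightarrow> t \<noteq> [] \<and> 1 \<notin> set t \<or> 1 \<in> set t" for t :: "bit list" by auto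
  then show ?thesis unfolding loop_orbits_def by blast
qed

lemma loop_orbits_disjoint:
  "loop_orbits (\<lambda>t. t \<noteq> [] \<and> 1 \<notin> set t) n \<inter> loop_orbits (\<lambda>t. 1 \<in> set t) n = {}"
proof -
  have False if "orbit (point w) = orbit (point w')" "length w = length w'" "aperiodic w"
    "run w (v, []) = Some (v, t)" "1 \<notin> set t" "run w' (v', []) = Some (v', t')" "1 \<in> set t'"
    for w w' v v' t t'
  proof -
    have "conjugate w w'" using that(1-3) orbit_point_eq unfolding aperiodic_def by blast
    from conjugate_level[OF this, of 1] run_level[OF that(4), of 1] run_level[OF that(6), of 1] that(5,7)
    show False by (simp add: count_list_0_iff)
  qed
  then show ?thesis unfolding loop_orbits_def by blast
qed

lemma finite_edge_words: "finite {w :: edge list. length w = n}"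
proof -
  have "e \<in> {BMinus 0, BMinus 1, BPlus 0, BPlus 1, UMinus, UPlus}" for e
    by (cases e; simp; metis bit.exhaust)
  then have "{w :: edge list. length w = n} \<subseteq>
      {w. set w \<subseteq> {BMinus 0, BMinus 1, BPlus 0, BPlus 1, UMinus, UPlus} \<and> length w = n}" by blast
  then show ?thesis by (rule finite_subset) (rule finite_lists_length_eq, simp)
qed

lemma finite_loop_orbits: "finite (loop_orbits P n)"
proof (rule finite_subset)
  show "loop_orbits P n \<subseteq> (\<lambda>w. orbit (point w)) ` {w. length w = n}"
    by (auto simp: loop_orbits_def)
qed (intro finite_imageI finite_edge_words)

lemma zero_blocks:
  assumes "run w (v, []) = Some (v', replicate (Suc k) 0)"
  shows "\<exists>x ws y. w = x @ blocks ws @ BMinus 0 # y \<and> run x (v, []) = Some (0, []) \<and>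
           (\<forall>u\<in>set ws. neutral u) \<and> run y (0, []) = Some (v', [])"
  using assms
proof (induction k arbitrary: w v)
  case 0
  then have "run w (v, []) = Some (v', [] @ [0])" by simp
  from run_bottom[OF this] obtain x y where "w = x @ BMinus 0 # y" "run x (v, []) = Some (0, [])"
    "run y (0, []) = Some (v', [])" by blast
  then show ?case by (intro exI[of _ x] exI[of _ "[]"] exI[of _ y]) simp
next
  case (Suc k)
  then have "run w (v, []) = Some (v', replicate (Suc k) 0 @ [0])"
    by (simp add: replicate_append_same)
  from run_bottom[OF this] obtain x w' where w': "w = x @ BMinus 0 # w'"
    "run x (v, []) = Some (0, [])" "run w' (0, []) = Some (v', replicate (Suc k) 0)" by blast
  from Suc.IH[OF w'(3)] obtain x' ws y where "w' = x' @ blocks ws @ BMinus 0 # y"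
    "neutral x'" "\<forall>u\<in>set ws. neutral u" "run y (0, []) = Some (v', [])"
    unfolding neutral_def by blast
  with w' show ?case
    by (intro exI[of _ x] exI[of _ "x' # ws"] exI[of _ y]) simp
qed

lemma conjugate_aperiodic:
  assumes "conjugate x y" "aperiodic x"
  shows "aperiodic y"
proof -
  from assms have ne: "x \<noteq> []" "y \<noteq> []" and len: "length x = length y"
    by (auto simp: aperiodic_def conjugate_def)
  have "orbit (point x) = orbit (point y)" using orbit_point_eq assms(1) len ne by blast
  then have "point y \<in> orbit (point x)" unfolding orbit_def by (metis rangeI shift_0)
  then obtain k where k: "point y = shift_by k (point x)" by (auto simp: orbit_def)
  have "shift_by m (point y) = point y \<longleftrightarrow> shift_by m (point x) = point x" for m
    unfolding k by (metis add.commute add.right_inverse shift_0 shift_shift)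
  then have eq: "periodic (point y) = periodic (point x)" "min_period (point y) = min_period (point x)"
    by (simp_all add: periodic_def min_period_def)
  from aperiodic_min_period[OF assms(2)] eq len have "periodic (point y)"
    "min_period (point y) = length y" by auto
  from aperiodic_factor(1)[OF this(1), of 0] this(2) factor_point[OF ne(2)] show ?thesis by simp
qed

text \<open>
  Rotating such a word to its first unmatched a moves the part before that letter to the end, where
  it joins the last block.
\<close>

lemma zero_orbit_blocks:
  assumes "X \<in> loop_orbits (\<lambda>t. t \<noteq> [] \<and> 1 \<notin> set t) n"
  obtains ws where "X = orbit (point (blocks ws))" "\<forall>w\<in>set ws. neutral w" "aperiodic ws"
    "length (blocks ws) = n"
proof -
  from assms obtain w v t where w: "X = orbit (point w)" "length w = n" "aperiodic w"
    "run w (v, []) = Some (v, t)" "t \<noteq> [] \<and> 1 \<notin> set t"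
    unfolding loop_orbits_def by blast
  from w(5)[unfolded zeros_iff] obtain k where "t = replicate (Suc k) 0"
    by (metis One_nat_def Suc_le_D)
  from zero_blocks[OF w(4)[unfolded this]] obtain x ws y where d: "w = x @ blocks ws @ BMinus 0 # y"
    "run x (v, []) = Some (0, [])" "\<forall>u\<in>set ws. neutral u" "run y (0, []) = Some (v, [])" by blast
  have n: "\<forall>u\<in>set (ws @ [y @ x]). neutral u" using d by (auto simp: neutral_def run_append)
  have c: "conjugate w (blocks (ws @ [y @ x]))"
    unfolding conjugate_def d(1) by (intro exI[of _ x] exI[of _ "blocks ws @ BMinus 0 # y"]) simp
  have len: "length w = length (blocks (ws @ [y @ x]))" using conjugate_length[OF c] .
  show thesis
  proof (rule that)
    show "X = orbit (point (blocks (ws @ [y @ x])))"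
      using w(1,3) orbit_point_eq[OF len] c by (simp add: aperiodic_def)
    show "aperiodic (ws @ [y @ x])"
      using aperiodic_blocks[of "ws @ [y @ x]"] n neutral_rising conjugate_aperiodic[OF c w(3)] by blast
  qed (use n len w(2) in simp_all)
qed


section \<open>Comparison of the two kinds of negative orbits\<close>

definition transfers :: "nat \<Rightarrow> (int \<Rightarrow> edge) set \<Rightarrow> (int \<Rightarrow> edge) set \<Rightarrow> bool" where
  "transfers n X Y \<longleftrightarrow> (\<exists>ws u. X = orbit (point (blocks ws)) \<and> Y = orbit (point u) \<and> ws \<noteq> [] \<and>
     length (blocks ws) = n \<and> length u = n \<and>
     ((\<exists>gs. u = blocks gs \<and> block_target ws gs) \<or> word_target ws u))"

lemma transfers_exists:
  assumes "X \<in> loop_orbits (\<lambda>t. t \<noteq> [] \<and> 1 \<notin> set t) n" "n \<notin> {1, 3, 5}"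
  shows "\<exists>Y\<in>loop_orbits (\<lambda>t. 1 \<in> set t) n. transfers n X Y"
proof -
  from assms(1) obtain ws where ws: "X = orbit (point (blocks ws))" "\<forall>w\<in>set ws. neutral w"
    "aperiodic ws" "length (blocks ws) = n" by (rule zero_orbit_blocks)
  with target_exists[of ws] assms(2) obtain ws' where c: "conjugate ws ws'"
    and t: "(\<exists>gs. block_target ws' gs \<and> aperiodic gs) \<or> (\<exists>g. word_target ws' g)" by blast
  have ne: "ws \<noteq> []" "ws' \<noteq> []" using ws(3) c by (auto simp: aperiodic_def conjugate_def)
  note cb = conjugate_blocks[OF c]
  have len: "length (blocks ws') = n" using conjugate_length[OF cb] ws(4) by simp
  have X: "X = orbit (point (blocks ws'))"
    using ws(1) orbit_point_eq[of "blocks ws" "blocks ws'"] cb ne(1) len ws(4) by simp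
  from t show ?thesis
  proof (elim disjE exE conjE)
    fix gs assume gs: "block_target ws' gs" "aperiodic gs"
    from run_blocks[OF block_target_rising(1)[OF gs(1)], of "[]"] block_target_rising(2)[OF gs(1)]
    obtain s where s: "run (blocks gs) (0, []) = Some (0, s)" "1 \<in> set s" by auto
    have "aperiodic (blocks gs)" using aperiodic_blocks block_target_rising(1)[OF gs(1)] gs(2) by blast
    moreover have "length (blocks gs) = n" using block_target_length[OF gs(1)] len by simp
    ultimately have "orbit (point (blocks gs)) \<in> loop_orbits (\<lambda>t. 1 \<in> set t) n"
      using s unfolding loop_orbits_def by blast
    with X len ne(2) gs(1) \<open>length (blocks gs) = n\<close> show ?thesis unfolding transfers_def by blast
  next
    fix g assume g: "word_target ws' g"
    have "length g = n" using word_target_length[OF g] len by simp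
    moreover have "run g (0, []) = Some (0, [1])" "(1::bit) \<in> set [1]" using word_target_run[OF g] by auto
    ultimately have "orbit (point g) \<in> loop_orbits (\<lambda>t. 1 \<in> set t) n"
      using word_target_aperiodic[OF g] unfolding loop_orbits_def by blast
    with X len ne(2) g \<open>length g = n\<close> show ?thesis unfolding transfers_def by blast
  qed
qed

text \<open>
  An image made of blocks has unmatched a, the others have none, so the two kinds are separated by
  the level. Within each kind the source is determined up to rotation.
\<close>

lemma transfers_unique:
  assumes "transfers n X Y" "transfers n X' Y"
  shows "X = X'"
proof -
  from assms(1) obtain ws u where u: "X = orbit (point (blocks ws))" "Y = orbit (point u)" "ws \<noteq> []"
     "length (blocks ws) = n" "length u = n"
     "(\<exists>gs. u = blocks gs \<and> block_target ws gs) \<or> word_target ws u"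
    unfolding transfers_def by blast
  from assms(2) obtain ws' u' where u': "X' = orbit (point (blocks ws'))" "Y = orbit (point u')"
     "ws' \<noteq> []" "length (blocks ws') = n" "length u' = n"
     "(\<exists>gs. u' = blocks gs \<and> block_target ws' gs) \<or> word_target ws' u'"
    unfolding transfers_def by blast
  have "u \<noteq> []" using u(3-5) by (metis blocks_eq_Nil length_0_conv)
  then have c: "conjugate u u'" using orbit_point_eq u u' by metis
  have no: False if "block_target vs hs" "word_target vs' z" "conjugate (blocks hs) z" for vs hs vs' z
  proof -
    from block_target_rising(2)[OF that(1)] have "hs \<noteq> []" by auto
    with run_blocks[OF block_target_rising(1)[OF that(1)], of "[]"]
    obtain s where "run (blocks hs) (0, []) = Some (0, s)" "0 \<in> set s" by auto
    with run_level[of "blocks hs" 0 "[]" 0 s 0] run_level[OF word_target_run[OF that(2)], of 0]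
      conjugate_level[OF that(3), of 0]
    show False by (simp add: count_list_0_iff)
  qed
  have "conjugate ws ws'"
    using u(6) u'(6)
  proof (elim disjE exE conjE)
    fix gs gs' assume g: "u = blocks gs" "block_target ws gs" "u' = blocks gs'" "block_target ws' gs'"
    then have "conjugate gs gs'"
      using c conjugate_blocksD block_target_rising(1) by blast
    then show ?thesis using block_target_unique g by blast
  next
    assume "word_target ws u" "word_target ws' u'"
    then have "ws = ws'"
      using word_target_unique conjugate_set[OF c] conjugate_length[OF c] by blast
    then show ?thesis by (simp add: conjugate_refl)
  qed (use c no conjugate_sym in blast)+
  then show ?thesis
    using u u' conjugate_blocks orbit_point_eq by (metis blocks_eq_Nil)
qed

lemma card_zero_le:
  assumes "n \<notin> {1, 3, 5}"
  shows "card (loop_orbits (\<lambda>t. t \<noteq> [] \<and> 1 \<notin> set t) n) \<le> card (loop_orbits (\<lambda>t. 1 \<in> set t) n)"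
  by (rule card_le_if_inj_on_rel[where r = "transfers n"])
     (use assms finite_loop_orbits transfers_exists transfers_unique in blast)+



section \<open>Time reversal\<close>

fun flip_gen :: "dyck_gen \<Rightarrow> dyck_gen" where
  "flip_gen (AMinus n) = APlus n"
| "flip_gen (APlus n) = AMinus n"

lemma flip_gen_idem [simp]: "flip_gen (flip_gen g) = g"
  by (cases g) simp_all

text \<open>
  Reversing words and exchanging \<open>\<alpha>\<^sub>-(n)\<close> with \<open>\<alpha>\<^sub>+(n)\<close> maps each defining relation to a defining
  relation.
\<close>

lemma dyck_cong_mirror:
  "dyck_cong x y \<Longrightarrow>
   dyck_cong (map_option (\<lambda>w. rev (map flip_gen w)) x) (map_option (\<lambda>w. rev (map flip_gen w)) y)"
proof (induction rule: dyck_cong.induct)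
  case (dyck_mult x x' y y')
  have *: "map_option (\<lambda>w. rev (map flip_gen w)) (zmult x y) =
      zmult (map_option (\<lambda>w. rev (map flip_gen w)) y) (map_option (\<lambda>w. rev (map flip_gen w)) x)" for x y
    by (cases x; cases y) simp_all
  show ?case unfolding * using dyck_mult.IH by (rule dyck_cong.dyck_mult[rotated])
qed (auto intro: dyck_cong.intros)

lift_definition mirror :: "dyck \<Rightarrow> dyck" is "map_option (\<lambda>w. rev (map flip_gen w))"
  by (rule dyck_cong_mirror)

lemma mirror_mirror [simp]: "mirror (mirror x) = x"
proof transfer
  fix x
  have "map_option (\<lambda>w. rev (map flip_gen w)) (map_option (\<lambda>w. rev (map flip_gen w)) x) = x"
    by (cases x) (simp_all add: rev_map comp_def)
  then show "dyck_cong (map_option (\<lambda>w. rev (map flip_gen w)) (map_option (\<lambda>w. rev (map flip_gen w)) x)) x"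
    by (simp add: dyck_refl)
qed

lemma mirror_mult: "mirror (x * y) = mirror y * mirror x"
proof transfer
  fix x y
  have "map_option (\<lambda>w. rev (map flip_gen w)) (zmult x y) =
      zmult (map_option (\<lambda>w. rev (map flip_gen w)) y) (map_option (\<lambda>w. rev (map flip_gen w)) x)"
    by (cases x; cases y) simp_all
  then show "dyck_cong (map_option (\<lambda>w. rev (map flip_gen w)) (zmult x y))
      (zmult (map_option (\<lambda>w. rev (map flip_gen w)) y) (map_option (\<lambda>w. rev (map flip_gen w)) x))"
    by (simp add: dyck_refl)
qed

lemma mirror_simps [simp]:
  "mirror 0 = 0" "mirror 1 = 1"
  "mirror (alpha_minus n) = alpha_plus n" "mirror (alpha_plus n) = alpha_minus n"
  by (simp_all add: zero_dyck_def one_dyck_def alpha_minus_def alpha_plus_def mirror.abs_eq)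

lemma mirror_minus: "mirror (prod_list (map alpha_minus ns)) = prod_list (map alpha_plus (rev ns))"
  by (induction ns) (simp_all add: mirror_mult)

lemma mirror_eq_iff: "mirror x = y \<longleftrightarrow> x = mirror y"
  by (metis mirror_mirror)

fun flip_edge :: "edge \<Rightarrow> edge" where
  "flip_edge (BMinus i) = BPlus i"
| "flip_edge (BPlus i) = BMinus i"
| "flip_edge UMinus = UPlus"
| "flip_edge UPlus = UMinus"

lemma flip_edge_simps [simp]:
  "flip_edge (flip_edge e) = e" "source (flip_edge e) = target e" "target (flip_edge e) = source e"
  "edge_label (flip_edge e) = mirror (edge_label e)"
  by (cases e; simp)+

lemma path_label_append: "path_label (x @ y) = path_label x * path_label y"
  by (simp add: path_label_def)

lemma path_label_mirror: "path_label (rev (map flip_edge w)) = mirror (path_label w)"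
  by (induction w) (simp_all add: path_label_append mirror_mult)

lemma directed_path_mirror: "directed_path (rev (map flip_edge w)) \<longleftrightarrow> directed_path w"
  unfolding directed_path_def successively_rev successively_map by (simp add: eq_commute)

definition mirror_point :: "(int \<Rightarrow> edge) \<Rightarrow> int \<Rightarrow> edge" where
  "mirror_point x i = flip_edge (x (- i))"

lemma mirror_point_idem [simp]: "mirror_point (mirror_point x) = x"
  by (simp add: mirror_point_def fun_eq_iff)

lemma mirror_point_eq: "mirror_point x = mirror_point y \<longleftrightarrow> x = y"
  by (metis mirror_point_idem)

lemma factor_mirror: "factor (mirror_point x) i n = rev (map flip_edge (factor x (1 - i - int n) n))"
  by (rule nth_equalityI) (auto simp: factor_def mirror_point_def rev_nth algebra_simps of_nat_diff)

lemma shift_mirror: "shift_by k (mirror_point x) = mirror_point (shift_by (- k) x)"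
  by (simp add: fun_eq_iff shift_by_def mirror_point_def)

lemma fibonacci_dyck_mirror:
  assumes "x \<in> fibonacci_dyck"
  shows "mirror_point x \<in> fibonacci_dyck"
  using assms
  by (auto simp: fibonacci_dyck_def factor_mirror path_label_mirror directed_path_mirror mirror_eq_iff)

lemma shift_uminus_fixed: "shift_by (- k) x = x \<longleftrightarrow> shift_by k x = x"
  by (metis add.left_inverse add.right_inverse shift_0 shift_shift)

lemma periodic_mirror:
  "periodic (mirror_point x) = periodic x" "min_period (mirror_point x) = min_period x"
  by (simp_all add: periodic_def min_period_def shift_mirror mirror_point_eq shift_uminus_fixed)

lemma orbit_mirror: "orbit (mirror_point x) = mirror_point ` orbit x"
proof -
  have "range (\<lambda>k. mirror_point (shift_by (- k) x)) = range (\<lambda>k. mirror_point (shift_by k x))"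
    by (auto intro: range_eqI[of _ _ "- _"])
  then show ?thesis by (simp add: orbit_def shift_mirror image_image)
qed

lemma card_periodic_orbits_mirror:
  assumes "\<And>p. Q (mirror_point p) \<longleftrightarrow> P p"
  shows "card (periodic_orbits Q n) = card (periodic_orbits P n)"
proof -
  have sub: "(`) mirror_point ` periodic_orbits P n \<subseteq> periodic_orbits Q n"
    if "\<And>p. P p \<Longrightarrow> Q (mirror_point p)" for P Q
  proof
    fix Y assume "Y \<in> (`) mirror_point ` periodic_orbits P n"
    then obtain p where "Y = orbit (mirror_point p)" "p \<in> fibonacci_dyck" "periodic p"
      "min_period p = n" "P p"
      by (auto simp: periodic_orbits_def orbit_mirror)
    with that[of p] fibonacci_dyck_mirror[of p] show "Y \<in> periodic_orbits Q n"
      unfolding periodic_orbits_def by (auto simp: periodic_mirror)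
  qed
  have P: "P (mirror_point p)" if "Q p" for p using assms[of "mirror_point p"] that by simp
  have "(`) mirror_point ` periodic_orbits P n = periodic_orbits Q n"
  proof
    show "(`) mirror_point ` periodic_orbits P n \<subseteq> periodic_orbits Q n"
      using sub[of P Q] assms by blast
    have "X = mirror_point ` (mirror_point ` X)" for X by (simp add: image_image)
    then show "periodic_orbits Q n \<subseteq> (`) mirror_point ` periodic_orbits P n"
      using sub[of Q P] P by (metis (no_types, lifting) image_subset_iff rev_image_eqI subsetI)
  qed
  moreover have "inj mirror_point" by (rule injI) (simp add: mirror_point_eq)
  then have "inj_on ((`) mirror_point) (periodic_orbits P n)"
    by (intro inj_onI) (simp add: inj_image_eq_iff)
  from card_image[OF this] have
    "card ((`) mirror_point ` periodic_orbits P n) = card (periodic_orbits P n)" .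
  ultimately show ?thesis by simp
qed

lemma period_label_mirror:
  "period_label (mirror_point p) i = mirror (period_label p (1 - i - int (min_period p)))"
  by (simp add: period_label_def periodic_mirror factor_mirror path_label_mirror)

lemma ex_mirror_period_label:
  "(\<exists>i. R (period_label (mirror_point p) i)) \<longleftrightarrow> (\<exists>i. R (mirror (period_label p i)))"
proof
  assume "\<exists>i. R (mirror (period_label p i))"
  then obtain i where "R (mirror (period_label p i))" by blast
  then have "R (period_label (mirror_point p) (1 - i - int (min_period p)))"
    by (simp add: period_label_mirror)
  then show "\<exists>i. R (period_label (mirror_point p) i)" by blast
qed (auto simp: period_label_mirror)

lemma mirror_dyck_minus: "mirror x \<in> dyck_plus \<longleftrightarrow> x \<in> dyck_minus"
proof -
  have "(\<exists>ns. ns \<noteq> [] \<and> mirror x = prod_list (map alpha_plus ns)) \<longleftrightarrow>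
        (\<exists>ns. ns \<noteq> [] \<and> x = prod_list (map alpha_minus ns))"
    using mirror_minus by (metis mirror_mirror rev_is_Nil_conv rev_rev_ident)
  then show ?thesis by (auto simp: dyck_minus_def dyck_plus_def)
qed

lemma card_positive: "card (periodic_orbits has_positive n) = card (periodic_orbits has_negative n)"
  by (rule card_periodic_orbits_mirror)
     (simp add: has_positive_def has_negative_def ex_mirror_period_label[where R = "\<lambda>x. x \<in> dyck_plus"]
        mirror_dyck_minus)

lemma mirror_power: "mirror (x ^ k) = mirror x ^ k"
  by (induction k) (simp_all add: mirror_mult power_commutes)

lemma card_multiplier_plus:
  "card (periodic_orbits (has_multiplier_plus \<mu>) n) = card (periodic_orbits (has_multiplier_minus \<mu>) n)"
proof (rule card_periodic_orbits_mirror)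
  have *: "mirror x = prod_list (map alpha_plus (rev ns)) ^ k \<longleftrightarrow> x = prod_list (map alpha_minus ns) ^ k"
    for x ns k by (metis mirror_minus mirror_mirror mirror_power)
  show "has_multiplier_plus \<mu> (mirror_point p) \<longleftrightarrow> has_multiplier_minus \<mu> p" for p
    unfolding has_multiplier_plus_def has_multiplier_minus_def
      ex_mirror_period_label[where
        R = "\<lambda>x. \<exists>ns\<in>\<mu>. \<exists>\<kappa>\<ge>1. x = prod_list (map alpha_plus (rev ns)) ^ \<kappa>"] *
    by (rule refl)
qed

lemma count_list_replicate: "count_list (replicate k x) x = k"
  by (induction k) simp_all

lemma act_plus_power: "act (alpha_plus n ^ k) (replicate k n) = Some []"
  by (induction k) (simp_all add: act_mult)

text \<open>
  The level of 0 over one period is positive for the negative multiplier and negative for the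
  positive one.
\<close>

lemma multiplier_zero_disjoint:
  "periodic_orbits (has_multiplier_minus (cyclic_class [0])) n \<inter>
   periodic_orbits (has_multiplier_plus (cyclic_class [0])) n = {}"
proof (rule equals0I)
  fix X
  assume "X \<in> periodic_orbits (has_multiplier_minus (cyclic_class [0])) n \<inter>
    periodic_orbits (has_multiplier_plus (cyclic_class [0])) n"
  then obtain p p' where p: "X = orbit p" "p \<in> fibonacci_dyck" "periodic p" "min_period p = n"
      "has_multiplier_minus (cyclic_class [0]) p"
    and p': "X = orbit p'" "p' \<in> fibonacci_dyck" "periodic p'" "min_period p' = n"
      "has_multiplier_plus (cyclic_class [0]) p'"
    by (auto simp: periodic_orbits_def)
  from p(4,5) obtain i k where k: "k \<ge> 1" "path_label (factor p i n) = alpha_minus 0 ^ k"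
    unfolding has_multiplier_minus_def class_zero by (auto simp: period_label_def)
  from p'(4,5) obtain j k' where k': "k' \<ge> 1" "path_label (factor p' j n) = alpha_plus 0 ^ k'"
    unfolding has_multiplier_plus_def class_zero by (auto simp: period_label_def)
  let ?w = "factor p i n" and ?w' = "factor p' j n"
  have ne: "?w \<noteq> []" "?w' \<noteq> []"
    using min_periodD(1)[OF p(3)] p(4) by (metis length_factor less_irrefl list.size(3))+
  have "prod_list (map alpha_minus (replicate k 0)) = alpha_minus 0 ^ k" by (induction k) auto
  then have "act (path_label ?w) [] = Some (replicate k 0)"
    using k(2) act_minus_word[of "replicate k 0" "[]"] by simp
  then have l: "level 0 ?w = int k"
    using act_run[OF _ ne(1)] p(2) run_level[of ?w _ "[]" _ "replicate k 0" 0]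
    by (fastforce simp: fibonacci_dyck_def count_list_replicate)
  have "act (path_label ?w') (replicate k' 0) = Some []" using k'(2) act_plus_power by simp
  then have l': "level 0 ?w' = - int k'"
    using act_run[OF _ ne(2)] p'(2) run_level[of ?w' _ "replicate k' 0" _ "[]" 0]
    by (fastforce simp: fibonacci_dyck_def count_list_replicate)
  have "orbit (point ?w) = orbit (point ?w')"
    using aperiodic_factor(2)[OF p(3), of i] aperiodic_factor(2)[OF p'(3), of j] p(1,4) p'(1,4) by simp
  then have "conjugate ?w ?w'" using orbit_point_eq[of ?w ?w'] ne by simp
  with conjugate_level[of ?w ?w' 0] l l' k(1) k'(1) show False by simp
qed

lemma exceptional_iff:
  "exceptional (cyclic_class [0]) n \<longleftrightarrow>
   card (loop_orbits (\<lambda>t. 1 \<in> set t) n) < card (loop_orbits (\<lambda>t. t \<noteq> [] \<and> 1 \<notin> set t) n)"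
proof -
  let ?A = "loop_orbits (\<lambda>t. t \<noteq> [] \<and> 1 \<notin> set t) n" and ?B = "loop_orbits (\<lambda>t. 1 \<in> set t) n"
  let ?M = "periodic_orbits (has_multiplier_plus (cyclic_class [0])) n"
  have "primitive [0::bit]"
    unfolding primitive_def
  proof (intro conjI notI)
    assume "\<exists>u k. k \<ge> 2 \<and> [0::bit] = concat (replicate k u)"
    then obtain u k where k: "k \<ge> 2" "[0::bit] = concat (replicate k u)" by blast
    then have "length [0::bit] = k * length u" by (simp add: length_concat sum_list_replicate)
    with k(1) show False by simp
  qed simp
  then have mem: "cyclic_class [0::bit] \<in> multipliers" by (auto simp: multipliers_def)
  have neg: "card (periodic_orbits has_negative n) = card ?A + card ?B"
    unfolding negative_orbits loop_orbits_split
    by (rule card_Un_disjoint) (rule finite_loop_orbits loop_orbits_disjoint)+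
  have "card ?M = card ?A" unfolding card_multiplier_plus multiplier_zero_orbits ..
  \<comment> \<open>If ?M were infinite, its cardinality would be 0, and that of ?A as well.\<close>
  moreover have "card (?A \<union> ?M) = card ?A + card ?M \<or> card ?M = 0 \<and> card ?A = 0"
  proof (cases "finite ?M")
    case True
    then show ?thesis
      using card_Un_disjoint[OF finite_loop_orbits True] multiplier_zero_disjoint
      unfolding multiplier_zero_orbits by blast
  next
    case False
    with \<open>card ?M = card ?A\<close> show ?thesis by simp
  qed
  moreover have "card (?A \<union> ?M) = 0" if "card ?M = 0" "card ?A = 0"
  proof (cases "finite ?M")
    case True
    with that finite_loop_orbits show ?thesis by simp
  qed simp
  ultimately have "card (?A \<union> ?M) = 2 * card ?A" by linarith
  then show ?thesis
    unfolding exceptional_def card_positive neg multiplier_zero_orbits using mem by auto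
qed


section \<open>Periods one, three and five\<close>

fun runs :: "nat \<Rightarrow> bit \<times> bit list \<Rightarrow> (edge list \<times> bit \<times> bit list) list" where
  "runs 0 q = [([], q)]"
| "runs (Suc n) q = concat (map (\<lambda>e. case step e q of None \<Rightarrow> [] | Some q' \<Rightarrow>
     map (\<lambda>(w, r). (e # w, r)) (runs n q')) [BMinus 0, BMinus 1, BPlus 0, BPlus 1, UMinus, UPlus])"

lemma runs_complete: "run w q = Some r \<Longrightarrow> (w, r) \<in> set (runs (length w) q)"
proof (induction w arbitrary: q)
  case (Cons e w)
  then obtain q' where q': "step e q = Some q'" "(w, r) \<in> set (runs (length w) q')"
    by (auto simp: bind_eq_Some_conv)
  have "e \<in> set [BMinus 0, BMinus 1, BPlus 0, BPlus 1, UMinus, UPlus]"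
    by (cases e; simp; metis bit.exhaust)
  moreover have "(e # w, r) \<in> set (case step e q of None \<Rightarrow> [] | Some q' \<Rightarrow>
     map (\<lambda>(w, r). (e # w, r)) (runs (length w) q'))"
    using q' by force
  ultimately show ?case unfolding list.size runs.simps(2) add_Suc_right add_0_right set_concat set_map
    by blast
qed simp

definition covering :: "nat \<Rightarrow> edge list list \<Rightarrow> bool" where
  "covering n us \<longleftrightarrow> list_all (\<lambda>v. list_all (\<lambda>(w, v', t). v' \<noteq> v \<or> 1 \<notin> set t \<or>
     list_ex (\<lambda>j. rotate j w = w) [1..<n] \<or> list_ex (\<lambda>j. rotate j w \<in> set us) [0..<n])
     (runs n (v, []))) [0, 1]"

definition separated :: "nat \<Rightarrow> edge list list \<Rightarrow> bool" where
  "separated n us \<longleftrightarrow> distinct us \<and> list_all (\<lambda>w. length w = n \<and>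
     (case run w (0, []) of None \<Rightarrow> False | Some (v, t) \<Rightarrow> v = 0 \<and> t \<noteq> [] \<and> 1 \<notin> set t) \<and>
     list_all (\<lambda>j. rotate j w \<noteq> w) [1..<n] \<and>
     list_all (\<lambda>u. u = w \<or> list_all (\<lambda>j. rotate j w \<noteq> u) [0..<n]) us) us"

lemma aperiodic_iff_rotate: "aperiodic w \<longleftrightarrow> w \<noteq> [] \<and> (\<forall>j\<in>{1..<length w}. rotate j w \<noteq> w)"
proof
  assume ap: "aperiodic w"
  have "rotate j w \<noteq> w" if "j \<in> {1..<length w}" for j
  proof
    assume "rotate j w = w"
    then have "w = drop j w @ take j w" using that by (simp add: rotate_drop_take)
    moreover have "w = take j w @ drop j w" by simp
    ultimately have "take j w = [] \<or> drop j w = []" using ap unfolding aperiodic_def by blast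
    with that show False by auto
  qed
  with ap show "w \<noteq> [] \<and> (\<forall>j\<in>{1..<length w}. rotate j w \<noteq> w)" by (simp add: aperiodic_def)
next
  assume w: "w \<noteq> [] \<and> (\<forall>j\<in>{1..<length w}. rotate j w \<noteq> w)"
  have "x = [] \<or> y = []" if "w = x @ y" "w = y @ x" for x y
  proof (rule ccontr)
    assume "\<not> (x = [] \<or> y = [])"
    with that(1) have "length x \<in> {1..<length w}" by (cases x; cases y) auto
    moreover have "rotate (length x) w = w" using that rotate_append by metis
    ultimately show False using w by blast
  qed
  with w show "aperiodic w" by (simp add: aperiodic_def)
qed

lemma conjugate_iff_rotate:
  "w \<noteq> [] \<Longrightarrow> conjugate w u \<longleftrightarrow> (\<exists>j\<in>{0..<length w}. rotate j w = u)"
  unfolding conjugate_rotate by (metis atLeast0LessThan length_greater_0_conv lessThan_iff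
    mod_less_divisor rotate_conv_mod)

lemma card_le_covering:
  assumes "covering n us" "\<forall>u\<in>set us. length u = n"
  shows "card (loop_orbits (\<lambda>t. 1 \<in> set t) n) \<le> length us"
proof -
  have "loop_orbits (\<lambda>t. 1 \<in> set t) n \<subseteq> (\<lambda>u. orbit (point u)) ` set us"
  proof
    fix X assume "X \<in> loop_orbits (\<lambda>t. 1 \<in> set t) n"
    then obtain w v t where w: "X = orbit (point w)" "length w = n" "aperiodic w"
      "run w (v, []) = Some (v, t)" "1 \<in> set t"
      by (auto simp: loop_orbits_def)
    from runs_complete[OF w(4)] w(2) have "(w, v, t) \<in> set (runs n (v, []))" by simp
    moreover have "v \<in> set [0, 1]" by (cases v) auto
    ultimately have "list_ex (\<lambda>j. rotate j w = w) [1..<n] \<or> list_ex (\<lambda>j. rotate j w \<in> set us) [0..<n]"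
      using assms(1) w(5) unfolding covering_def list_all_iff by fastforce
    then obtain j where "rotate j w \<in> set us"
      using w(2,3) unfolding aperiodic_iff_rotate list_ex_iff by auto
    moreover have "orbit (point w) = orbit (point (rotate j w))"
      using orbit_point_eq[of w "rotate j w"] w(3) unfolding aperiodic_def conjugate_rotate by auto
    ultimately show "X \<in> (\<lambda>u. orbit (point u)) ` set us" using w(1) by blast
  qed
  then have "card (loop_orbits (\<lambda>t. 1 \<in> set t) n) \<le> card ((\<lambda>u. orbit (point u)) ` set us)"
    by (intro card_mono) auto
  also have "\<dots> \<le> length us" by (meson card_image_le card_length finite_set le_trans)
  finally show ?thesis .
qed

lemma card_ge_separated:
  assumes "separated n us" "n > 0"
  shows "length us \<le> card (loop_orbits (\<lambda>t. t \<noteq> [] \<and> 1 \<notin> set t) n)"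
proof -
  have w: "length w = n" "w \<noteq> []" "aperiodic w"
    "\<exists>t. run w (0, []) = Some (0, t) \<and> t \<noteq> [] \<and> 1 \<notin> set t"
    "\<And>u. u \<in> set us \<Longrightarrow> conjugate w u \<Longrightarrow> u = w"
    if "w \<in> set us" for w
  proof -
    from assms(1) that have s: "length w = n"
      "case run w (0, []) of None \<Rightarrow> False | Some (v, t) \<Rightarrow> v = 0 \<and> t \<noteq> [] \<and> 1 \<notin> set t"
      "\<forall>j\<in>{1..<n}. rotate j w \<noteq> w" "\<forall>u\<in>set us. u = w \<or> (\<forall>j\<in>{0..<n}. rotate j w \<noteq> u)"
      unfolding separated_def list_all_iff by auto
    then show len: "length w = n" and ne: "w \<noteq> []" using assms(2) by auto
    show "aperiodic w" using s(3) len ne aperiodic_iff_rotate by blast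
    show "\<exists>t. run w (0, []) = Some (0, t) \<and> t \<noteq> [] \<and> 1 \<notin> set t"
      using s(2) by (auto split: option.splits prod.splits)
    show "u = w" if "u \<in> set us" "conjugate w u" for u
      using s(4) that conjugate_iff_rotate[OF ne] len by blast
  qed
  have "inj_on (\<lambda>u. orbit (point u)) (set us)"
    by (rule inj_onI) (metis w(1,2,5) orbit_point_eq)
  then have "card ((\<lambda>u. orbit (point u)) ` set us) = length us"
    using assms(1) by (simp add: card_image distinct_card separated_def)
  moreover have "(\<lambda>u. orbit (point u)) ` set us \<subseteq> loop_orbits (\<lambda>t. t \<noteq> [] \<and> 1 \<notin> set t) n"
    unfolding loop_orbits_def using w by blast
  ultimately show ?thesis using card_mono[OF finite_loop_orbits] by metis
qed

lemma exceptional_1: "exceptional (cyclic_class [0]) 1"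
proof -
  have "covering 1 []" "separated 1 [[BMinus 0]]" by code_simp+
  from card_le_covering[OF this(1)] card_ge_separated[OF this(2)] show ?thesis
    by (simp add: exceptional_iff)
qed

lemma exceptional_3: "exceptional (cyclic_class [0]) 3"
proof -
  have "covering 3 [[BMinus 0, UMinus, BMinus 1]]"
    "separated 3 [[BMinus 0, BMinus 0, BPlus 0], [BMinus 0, UMinus, UPlus]]" by code_simp+
  from card_le_covering[OF this(1)] card_ge_separated[OF this(2)] show ?thesis
    by (simp add: exceptional_iff)
qed

lemma exceptional_5: "exceptional (cyclic_class [0]) 5"
proof -
  have "covering 5
    [[BMinus 0, UMinus, BMinus 1, BMinus 0, BPlus 0],
     [BMinus 0, UMinus, BMinus 1, UMinus, UPlus],
     [BMinus 0, UMinus, BMinus 1, BPlus 1, BMinus 1],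
     [BMinus 0, BMinus 0, BPlus 0, UMinus, BMinus 1],
     [BMinus 0, UMinus, UPlus, UMinus, BMinus 1],
     [BMinus 0, UMinus, BMinus 1, UMinus, BMinus 1],
     [BMinus 0, BMinus 0, BMinus 0, UMinus, BMinus 1]]" by code_simp
  note B = card_le_covering[OF this]
  have "separated 5
    [[BMinus 0, BMinus 0, BMinus 0, BPlus 0, BPlus 0],
     [BMinus 0, BMinus 0, UMinus, UPlus, BPlus 0],
     [BMinus 0, BMinus 0, BPlus 0, BMinus 0, BPlus 0],
     [BMinus 0, BMinus 0, BPlus 0, UMinus, UPlus],
     [BMinus 0, UMinus, UPlus, BMinus 0, BPlus 0],
     [BMinus 0, UMinus, UPlus, UMinus, UPlus],
     [BMinus 0, UMinus, BMinus 1, BPlus 1, UPlus],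
     [BMinus 0, BMinus 0, BMinus 0, BMinus 0, BPlus 0],
     [BMinus 0, BMinus 0, BMinus 0, UMinus, UPlus]]" by code_simp
  from B card_ge_separated[OF this] show ?thesis
    by (simp add: exceptional_iff)
qed

theorem propositionM0:
  fixes n :: nat
  shows "exceptional (cyclic_class [0]) n \<longleftrightarrow> n \<in> {1, 3, 5}"
proof
  show "n \<in> {1, 3, 5}" if "exceptional (cyclic_class [0]) n"
    using that card_zero_le[of n] unfolding exceptional_iff by force
  show "exceptional (cyclic_class [0]) n" if "n \<in> {1, 3, 5}"
    using that exceptional_1 exceptional_3 exceptional_5 by auto
qed


end
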